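(* Let $N\ge 1$ and let $M\in\mathbb{N}$ with $M\ge 2$. Let $\Omega=\Omega_1\cup\cdots\cup\Omega_M\subset\mathbb{R}^N$, where each $\Omega_j$ is an open, bounded, connected set with $C^1$ boundary, and $\overline{\Omega_i}\cap\overline{\Omega_j}=\emptyset$ for $i\neq j$. Let $\mu^-$ be a nonnegative finite Borel measure on $[0,1]$ such that $\mu^-((0,\overline s))>0$ for some $\overline s\in(0,1)$. Consider the problem $$-\Delta u=\lambda\int_{[0,\overline s)}(-\Delta)^s u\,d\mu^-(s)\ \text{ in }\Omega,\qquad u=0\ \text{ in }\mathbb{R}^N\setminus\Omega,$$ with first eigenvalue $$\lambda_{\overline s}=\min_{u\in H^1_0(\Omega)\setminus\{0\}}\frac{\int_\Omega|\nabla u|^2}{\int_{[0,\overline s)}[u]_s^2\,d\mu^-(s)}.$$ Then any eigenfunction associated with $\lambda_{\overline s}$ changes sign, i.e. it takes both strictly positive and strictly negative values.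
   Context: Functions in $H^1_0(\Omega)$ are extended by zero outside $\Omega$. For $s\in(0,1)$, $$(-\Delta)^s u(x)=c_{N,s}\int_{\mathbb{R}^N}\frac{2u(x)-u(x+y)-u(x-y)}{|y|^{N+2s}}\,dy,\qquad c_{N,s}=\frac{2^{2s-1}\Gamma(\frac{N+2s}{2})}{\pi^{N/2}\Gamma(2-s)}s(1-s),$$ and $(-\Delta)^0u=u$. The seminorms are $[u]_0=\|u\|_{L^2}$ and $$[u]_s^2=c_{N,s}\iint\frac{|u(x)-u(y)|^2}{|x-y|^{N+2s}}\,dx\,dy\quad\text{for } s\in(0,1).$$ The bilinear forms $\langle u,v\rangle_s$ are defined analogously. An eigenfunction associated with $\lambda$ is $u\in H^1_0(\Omega)\setminus\{0\}$ with $$\int_\Omega\nabla u\cdot\nabla v=\lambda\int_{[0,\overline s)}\langle u,v\rangle_s\,d\mu^-(s)\quad\text{for all } v\in C_c^\infty(\Omega).$$ *)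

theory Defs
  imports "HOL-Analysis.Analysis" "HOL-Probability.Probability"
begin

definition grad :: "('a::euclidean_space \<Rightarrow> real) \<Rightarrow> 'a \<Rightarrow> 'a" where
  "grad f x = (\<Sum>b\<in>Basis. frechet_derivative f (at x) b *\<^sub>R b)"

fun dirderivs :: "'a::euclidean_space list \<Rightarrow> ('a \<Rightarrow> real) \<Rightarrow> 'a \<Rightarrow> real" where
  "dirderivs [] f = f"
| "dirderivs (v # vs) f = (\<lambda>x. frechet_derivative (dirderivs vs f) (at x) v)"

definition smooth :: "('a::euclidean_space \<Rightarrow> real) \<Rightarrow> bool" where
  "smooth f \<longleftrightarrow> (\<forall>vs x. dirderivs vs f differentiable (at x))"

definition tsupp :: "('a::euclidean_space \<Rightarrow> real) \<Rightarrow> 'a set" where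
  "tsupp f = closure {x. f x \<noteq> 0}"

definition test_fun :: "'a::euclidean_space set \<Rightarrow> ('a \<Rightarrow> real) \<Rightarrow> bool" where
  "test_fun \<Omega> f \<longleftrightarrow> smooth f \<and> compact (tsupp f) \<and> tsupp f \<subseteq> \<Omega>"

definition C1_boundary :: "'a::euclidean_space set \<Rightarrow> bool" where
  "C1_boundary \<Omega> \<longleftrightarrow>
     (\<forall>x\<in>frontier \<Omega>. \<exists>U \<phi>. open U \<and> x \<in> U \<and>
        (\<forall>y\<in>U. \<phi> differentiable (at y)) \<and> continuous_on U (grad \<phi>) \<and>
        grad \<phi> x \<noteq> 0 \<and> \<Omega> \<inter> U = {y\<in>U. \<phi> y < 0})"

definition H10_grad :: "'a::euclidean_space set \<Rightarrow> ('a \<Rightarrow> real) \<Rightarrow> ('a \<Rightarrow> 'a) \<Rightarrow> bool" where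
  "H10_grad \<Omega> u G \<longleftrightarrow>
     u \<in> borel_measurable lebesgue \<and> G \<in> borel_measurable lebesgue \<and>
     (\<exists>\<phi>::nat \<Rightarrow> 'a \<Rightarrow> real. (\<forall>k. test_fun \<Omega> (\<phi> k)) \<and>
        ((\<lambda>k. \<integral>\<^sup>+x. ennreal ((\<phi> k x - u x)\<^sup>2) \<partial>lebesgue) \<longlonglongrightarrow> 0) \<and>
        ((\<lambda>k. \<integral>\<^sup>+x. ennreal ((norm (grad (\<phi> k) x - G x))\<^sup>2) \<partial>lebesgue) \<longlonglongrightarrow> 0))"

definition H10 :: "'a::euclidean_space set \<Rightarrow> ('a \<Rightarrow> real) set" where
  "H10 \<Omega> = {u. \<exists>G. H10_grad \<Omega> u G}"

text \<open>The (a.e.-unique) weak gradient of an H^1_0 function.\<close>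
definition wgrad :: "'a::euclidean_space set \<Rightarrow> ('a \<Rightarrow> real) \<Rightarrow> 'a \<Rightarrow> 'a" where
  "wgrad \<Omega> u = (SOME G. H10_grad \<Omega> u G)"

definition cNs :: "nat \<Rightarrow> real \<Rightarrow> real" where
  "cNs n s = 2 powr (2 * s - 1) * Gamma ((real n + 2 * s) / 2)
              / (pi powr (real n / 2) * Gamma (2 - s)) * s * (1 - s)"

definition frac_form :: "real \<Rightarrow> ('a::euclidean_space \<Rightarrow> real) \<Rightarrow> ('a \<Rightarrow> real) \<Rightarrow> real" where
  "frac_form s u v =
     (if s = 0 then (\<integral>x. u x * v x \<partial>lebesgue)
      else cNs DIM('a) s *
        (\<integral>p. (u (fst p) - u (snd p)) * (v (fst p) - v (snd p))
               / norm (fst p - snd p) powr (real DIM('a) + 2 * s)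
            \<partial>(lebesgue \<Otimes>\<^sub>M lebesgue)))"

definition frac_sq :: "real \<Rightarrow> ('a::euclidean_space \<Rightarrow> real) \<Rightarrow> real" where
  "frac_sq s u = frac_form s u u"

definition nonzero_fun :: "('a::euclidean_space \<Rightarrow> real) \<Rightarrow> bool" where
  "nonzero_fun u \<longleftrightarrow> \<not> (AE x in lebesgue. u x = 0)"

definition first_eig :: "'a::euclidean_space set \<Rightarrow> real measure \<Rightarrow> real \<Rightarrow> real" where
  "first_eig \<Omega> \<mu> sb =
     (INF u\<in>{u\<in>H10 \<Omega>. nonzero_fun u}.
        (\<integral>x. (norm (wgrad \<Omega> u x))\<^sup>2 \<partial>lebesgue) /
        (LINT s:{0..<sb}|\<mu>. frac_sq s u))"

definition eigenfunction ::
  "'a::euclidean_space set \<Rightarrow> real measure \<Rightarrow> real \<Rightarrow> real \<Rightarrow> ('a \<Rightarrow> real) \<Rightarrow> bool" where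
  "eigenfunction \<Omega> \<mu> sb lam u \<longleftrightarrow>
     u \<in> H10 \<Omega> \<and> nonzero_fun u \<and>
     (\<forall>v. test_fun \<Omega> v \<longrightarrow>
        (\<integral>x. wgrad \<Omega> u x \<bullet> grad v x \<partial>lebesgue) =
        lam * (LINT s:{0..<sb}|\<mu>. frac_form s u v))"

end

theory Submission
  imports Defs
begin

text \<open>
Split \<open>\<Omega>\<close> into one component \<open>A\<close> and the union \<open>B\<close> of the others, and suppose that an eigenfunction \<open>u\<close>
for the first eigenvalue \<open>\<lambda>\<close> is nonnegative. Restricting to \<open>A\<close> and to its complement writes
\<open>u = v + w\<close> with \<open>v\<close>, \<open>w\<close> in the energy space. For disjointly supported nonnegative functions
the nonlocal form has the sign of \<open>- v x * w y\<close>, so \<open>\<langle>v, w\<rangle> < 0\<close> unless one of them vanishes.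
Testing the equation with \<open>v\<close> gives \<open>\<parallel>\<nabla>v\<parallel>\<^sup>2 = \<lambda> (\<langle>v, v\<rangle> + \<langle>w, v\<rangle>)\<close>, while minimality gives
\<open>\<lambda> \<langle>v, v\<rangle> \<le> \<parallel>\<nabla>v\<parallel>\<^sup>2\<close>: a contradiction when \<open>v\<close> and \<open>w\<close> are both nonzero. If \<open>u\<close> vanishes on one of the
two parts, testing with a nonnegative function supported there gives \<open>0\<close> on the local side and a
strictly negative number on the nonlocal side.
\<close>

section \<open>Smooth functions and test functions\<close>

text \<open>The eigenvalue equation is given only for test functions, whereas \<open>v\<close> is
  merely a Sobolev function, so both sides must be continuous in the H^1 norm. On the nonlocal side
  this takes a bound of \<open>frac_sq s u\<close> by the H^1 norm that is uniform in
  \<open>s\<close>: the seminorm is estimated through the L2 modulus of continuity, and the factor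
  \<open>s * (1 - s)\<close> in \<open>cNs\<close> cancels the divergence at both ends. The same
  bound makes the forms integrable; Bochner integrals of non-integrable functions are 0 by
  convention, and linearity could fail.

  Cutting off by an indicator stays inside H^1_0 because it maps test functions to test functions:
  their compact support lies in a disjoint union of open sets. As \<open>wgrad\<close> is an
  arbitrary choice, weak gradients must be shown unique up to null sets before minimality applies to
  a restriction.

  The contradiction requires \<lambda> > 0: it is nonnegative as an infimum of quotients, and
  \<lambda> = 0 would force a zero gradient and then \<open>u = 0\<close>. Strictness comes from
  exponents in the open interval, since at \<open>s = 0\<close> disjointly supported functions are
  orthogonal. Nonpositive eigenfunctions reduce to nonnegative ones through
  \<open>- u\<close>.\<close>

lemma smooth_coinduct:
  assumes "f \<in> C"
    and diff: "\<And>f x. f \<in> C \<Longrightarrow> f differentiable (at x)"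
    and deriv: "\<And>f v. f \<in> C \<Longrightarrow> (\<lambda>x. frechet_derivative f (at x) v) \<in> C"
  shows "smooth f"
proof -
  have "dirderivs vs f \<in> C" for vs
    by (induction vs) (auto intro: deriv \<open>f \<in> C\<close>)
  then show ?thesis
    unfolding smooth_def using diff by blast
qed

lemma smooth_differentiable: "smooth f \<Longrightarrow> f differentiable (at x)"
  unfolding smooth_def by (metis dirderivs.simps(1))

lemma smooth_frechet_derivative:
  assumes "smooth f"
  shows "smooth (\<lambda>x. frechet_derivative f (at x) v)"
proof -
  have "dirderivs vs (\<lambda>x. frechet_derivative f (at x) v) = dirderivs (vs @ [v]) f" for vs
    by (induction vs) auto
  then show ?thesis
    using assms unfolding smooth_def by metis
qed

lemma smooth_has_derivative:
  "smooth f \<Longrightarrow> (f has_derivative frechet_derivative f (at x)) (at x)"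
  using smooth_differentiable frechet_derivative_works by blast

lemma smooth_continuous_on: "smooth f \<Longrightarrow> continuous_on S f"
  by (meson continuous_at_imp_continuous_on differentiable_imp_continuous_within smooth_differentiable)

text \<open>Iterated directional derivatives never leave such a family, so smoothness reduces to one
  derivative formula and one stability check. The index can record data, such as a coefficient or a
  pair of functions, that the function alone would hide.\<close>

lemma smooth_familyI:
  assumes "i \<in> I"
    and deriv: "\<And>i x. i \<in> I \<Longrightarrow> (F i has_derivative (\<lambda>v. F (d v i) x)) (at x)"
    and closed: "\<And>i v. i \<in> I \<Longrightarrow> d v i \<in> I"
  shows "smooth (F i)"
proof (rule smooth_coinduct[where C = "F ` I"])
  fix f x v assume "f \<in> F ` I"
  then obtain i where i: "i \<in> I" "f = F i" by blast
  show "f differentiable (at x)"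
    unfolding i(2) by (rule differentiableI[OF deriv[OF i(1)]])
  have "(\<lambda>x. frechet_derivative f (at x) v) = F (d v i)"
    unfolding i(2) by (simp add: frechet_derivative_at[OF deriv[OF i(1)], symmetric])
  then show "(\<lambda>x. frechet_derivative f (at x) v) \<in> F ` I"
    using closed[OF i(1), of v] by simp
qed (rule imageI[OF assms(1)])

abbreviation dird :: "'a::euclidean_space \<Rightarrow> ('a \<Rightarrow> real) \<Rightarrow> 'a \<Rightarrow> real" where
  "dird v f \<equiv> \<lambda>x. frechet_derivative f (at x) v"

lemma smooth_add:
  assumes "smooth f" "smooth g"
  shows "smooth (\<lambda>x. f x + g x)"
proof -
  have "smooth ((\<lambda>(f, g) x. f x + g x) (f, g))"
    by (rule smooth_familyI[where I = "{f. smooth f} \<times> {g. smooth g}"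
          and d = "\<lambda>v (f, g). (dird v f, dird v g)"])
      (use assms in \<open>auto intro!: has_derivative_add smooth_has_derivative smooth_frechet_derivative\<close>)
  then show ?thesis by simp
qed

text \<open>The free coefficient \<open>c\<close> absorbs the chain rule factor \<open>r\<close>: a
  directional derivative is again of this form, with \<open>c * r\<close> in place of
  \<open>c\<close>, so the class is closed under differentiation.\<close>

lemma affine_has_derivative:
  assumes "smooth f"
  shows "((\<lambda>x. c * f (a + r *\<^sub>R x)) has_derivative
      (\<lambda>v. (c * r) * frechet_derivative f (at (a + r *\<^sub>R x)) v)) (at x)"
proof -
  have "((\<lambda>x. a + r *\<^sub>R x) has_derivative (\<lambda>v. r *\<^sub>R v)) (at x)"
    by (auto intro!: derivative_eq_intros)
  then have "((\<lambda>x. f (a + r *\<^sub>R x)) has_derivative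
      (\<lambda>v. frechet_derivative f (at (a + r *\<^sub>R x)) (r *\<^sub>R v))) (at x)"
    using has_derivative_compose smooth_has_derivative[OF assms] by blast
  then have "((\<lambda>x. c * f (a + r *\<^sub>R x)) has_derivative
      (\<lambda>v. c * frechet_derivative f (at (a + r *\<^sub>R x)) (r *\<^sub>R v))) (at x)"
    by (rule has_derivative_mult_right)
  then show ?thesis
    using linear_frechet_derivative[OF smooth_differentiable[OF assms]]
    by (simp add: linear_cmul mult.assoc)
qed

lemma smooth_affine:
  assumes "smooth f"
  shows "smooth (\<lambda>x. c * f (a + r *\<^sub>R x))"
proof -
  have "smooth ((\<lambda>(c, f) x. c * f (a + r *\<^sub>R x)) (c, f))"
    by (rule smooth_familyI[where I = "UNIV \<times> {f. smooth f}" and d = "\<lambda>v (c, f). (c * r, dird v f)"])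
      (use assms affine_has_derivative in \<open>auto intro!: smooth_frechet_derivative\<close>)
  then show ?thesis by simp
qed

lemma smooth_cmult: "smooth f \<Longrightarrow> smooth (\<lambda>x. c * f x)"
  using smooth_affine[of f c 0 1] by simp

lemma smooth_diff:
  assumes "smooth f" "smooth g"
  shows "smooth (\<lambda>x. f x - g x)"
  using smooth_add[OF assms(1) smooth_cmult[OF assms(2), of "-1"]] by simp

text \<open>The derivative of a product is a sum of products, so the family closed under differentiation has to
contain finite sums.\<close>

inductive_set smooth_products :: "('a::euclidean_space \<Rightarrow> real) set" where
  "smooth f \<Longrightarrow> smooth g \<Longrightarrow> (\<lambda>x. f x * g x) \<in> smooth_products"
| "f \<in> smooth_products \<Longrightarrow> g \<in> smooth_products \<Longrightarrow> (\<lambda>x. f x + g x) \<in> smooth_products"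

lemma smooth_mult:
  assumes "smooth f" "smooth g"
  shows "smooth (\<lambda>x. f x * g x)"
proof (rule smooth_coinduct[where C = smooth_products])
  show d: "f differentiable (at x)" if "f \<in> smooth_products" for f :: "'a \<Rightarrow> real" and x
    using that
    by induction (simp_all add: smooth_differentiable)
  show "(\<lambda>x. frechet_derivative f (at x) v) \<in> smooth_products"
    if "f \<in> smooth_products" for f :: "'a \<Rightarrow> real" and v
    using that
  proof induction
    case (1 f g)
    note D = has_derivative_mult[OF smooth_has_derivative[OF 1(1)] smooth_has_derivative[OF 1(2)]]
    have "(\<lambda>x. frechet_derivative (\<lambda>x. f x * g x) (at x) v) =
       (\<lambda>x. f x * frechet_derivative g (at x) v + frechet_derivative f (at x) v * g x)"
      by (simp add: frechet_derivative_at[OF D, symmetric])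
    then show ?case
      using smooth_products.intros(2)[OF smooth_products.intros(1)[OF 1(1) smooth_frechet_derivative[OF 1(2)]]
          smooth_products.intros(1)[OF smooth_frechet_derivative[OF 1(1)] 1(2)]] by simp
  next
    case (2 f g)
    note D = has_derivative_add[OF d[OF 2(1), unfolded frechet_derivative_works]
        d[OF 2(2), unfolded frechet_derivative_works]]
    have "(\<lambda>x. frechet_derivative (\<lambda>x. f x + g x) (at x) v) =
       (\<lambda>x. frechet_derivative f (at x) v + frechet_derivative g (at x) v)"
      by (simp add: frechet_derivative_at[OF D, symmetric])
    then show ?case
      using smooth_products.intros(2)[OF 2(3,4)] by simp
  qed
qed (rule smooth_products.intros(1)[OF assms])

section \<open>Supports, restriction to an open piece, and gradients\<close>

lemma tsupp_eq_0: "x \<notin> tsupp f \<Longrightarrow> f x = 0"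
  using closure_subset[of "{x. f x \<noteq> 0}"] by (auto simp: tsupp_def)

lemma tsupp_subset: "closed S \<Longrightarrow> (\<And>x. f x \<noteq> 0 \<Longrightarrow> x \<in> S) \<Longrightarrow> tsupp f \<subseteq> S"
  unfolding tsupp_def by (intro closure_minimal) auto

lemma closed_tsupp: "closed (tsupp f)"
  by (simp add: tsupp_def)

lemma has_derivative_0_off_tsupp:
  assumes "x \<notin> tsupp f"
  shows "(f has_derivative (\<lambda>v. 0)) (at x)"
proof (rule has_derivative_transform_within_open)
  show "((\<lambda>x. 0) has_derivative (\<lambda>v. 0)) (at x)" by simp
  show "open (- tsupp f)" by (rule open_Compl[OF closed_tsupp])
  show "x \<in> - tsupp f" using assms by simp
  show "0 = f y" if "y \<in> - tsupp f" for y using that tsupp_eq_0[of y f] by simp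
qed

lemma frechet_derivative_off_tsupp: "x \<notin> tsupp f \<Longrightarrow> frechet_derivative f (at x) v = 0"
  by (simp add: frechet_derivative_at[OF has_derivative_0_off_tsupp, symmetric])

lemma grad_off_tsupp: "x \<notin> tsupp f \<Longrightarrow> grad f x = 0"
  by (simp add: grad_def frechet_derivative_off_tsupp)

lemma tsupp_frechet_derivative: "tsupp (\<lambda>x. frechet_derivative f (at x) v) \<subseteq> tsupp f"
  by (intro tsupp_subset closed_tsupp) (metis frechet_derivative_off_tsupp)

lemma tsupp_restrict: "tsupp (\<lambda>x. indicator A x * f x) \<subseteq> tsupp f"
proof (rule tsupp_subset[OF closed_tsupp])
  fix x assume "indicator A x * f x \<noteq> 0"
  then show "x \<in> tsupp f" using tsupp_eq_0[of x f] by auto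
qed

text \<open>The indicator is locally constant on the disjoint open sets \<open>A\<close> and
  \<open>B\<close>, and any other point has a neighbourhood on which \<open>f\<close>
  vanishes.\<close>

lemma restrict_has_derivative:
  fixes f :: "'a::euclidean_space \<Rightarrow> real"
  assumes "smooth f" "tsupp f \<subseteq> A \<union> B" "open A" "open B" "A \<inter> B = {}"
  shows "((\<lambda>x. indicator A x * f x) has_derivative
           (\<lambda>v. indicator A x * frechet_derivative f (at x) v)) (at x)"
proof -
  consider "x \<in> A" | "x \<in> B" "x \<notin> A" | "x \<notin> tsupp f"
    using assms(2) by auto
  then show ?thesis
  proof cases
    case 1
    have "((\<lambda>x. indicator A x * f x) has_derivative frechet_derivative f (at x)) (at x)"
      by (rule has_derivative_transform_within_open[OF smooth_has_derivative[OF assms(1)] \<open>open A\<close> 1])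
        simp
    then show ?thesis using 1 by simp
  next
    case 2
    have "((\<lambda>x. indicator A x * f x) has_derivative (\<lambda>v. 0)) (at x)"
      by (rule has_derivative_transform_within_open[OF _ \<open>open B\<close> 2(1), where f = "\<lambda>x. 0"])
        (use assms(5) in \<open>auto simp: indicator_def\<close>)
    then show ?thesis using 2 by simp
  next
    case 3
    then have "x \<notin> tsupp (\<lambda>x. indicator A x * f x)"
      using tsupp_restrict[of A f] by blast
    from has_derivative_0_off_tsupp[OF this] show ?thesis
      using 3 by (simp add: frechet_derivative_off_tsupp)
  qed
qed

lemma smooth_restrict:
  assumes "smooth f" "tsupp f \<subseteq> A \<union> B" "open A" "open B" "A \<inter> B = {}"
  shows "smooth (\<lambda>x. indicator A x * f x)"
proof (rule smooth_familyI[where F = "\<lambda>f x. indicator A x * f x" and d = dird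
        and I = "{f. smooth f \<and> tsupp f \<subseteq> A \<union> B}"])
  fix g assume "g \<in> {f. smooth f \<and> tsupp f \<subseteq> A \<union> B}"
  then have g: "smooth g" "tsupp g \<subseteq> A \<union> B" by auto
  show "((\<lambda>x. indicator A x * g x) has_derivative (\<lambda>v. indicator A x * dird v g x)) (at x)" for x
    by (rule restrict_has_derivative[OF g assms(3-5)])
  show "dird v g \<in> {f. smooth f \<and> tsupp f \<subseteq> A \<union> B}" for v
    using smooth_frechet_derivative[OF g(1)] tsupp_frechet_derivative[of g v] g(2) by auto
qed (use assms in auto)

lemma grad_inner:
  assumes "f differentiable (at x)"
  shows "grad f x \<bullet> v = frechet_derivative f (at x) v"
proof -
  interpret linear "frechet_derivative f (at x)"
    by (rule linear_frechet_derivative[OF assms])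
  have "frechet_derivative f (at x) v = frechet_derivative f (at x) (\<Sum>b\<in>Basis. (v \<bullet> b) *\<^sub>R b)"
    by (simp add: euclidean_representation)
  also have "\<dots> = (\<Sum>b\<in>Basis. (v \<bullet> b) * frechet_derivative f (at x) b)"
    by (simp add: sum scale)
  finally show ?thesis
    by (simp add: grad_def inner_sum_left inner_commute[of v] mult.commute)
qed

lemma grad_eqI:
  assumes "(f has_derivative f') (at x)" "\<And>v. f' v = w \<bullet> v"
  shows "grad f x = w"
proof -
  have "grad f x \<bullet> v = w \<bullet> v" for v
    using grad_inner[OF differentiableI[OF assms(1)], of v] assms(2)
    by (simp add: frechet_derivative_at[OF assms(1), symmetric])
  then show ?thesis
    using vector_eq_rdot by blast
qed

lemma smooth_grad_inner: "smooth f \<Longrightarrow> grad f x \<bullet> v = frechet_derivative f (at x) v"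
  by (simp add: grad_inner smooth_differentiable)

lemma continuous_on_grad:
  assumes "smooth f"
  shows "continuous_on S (grad f)"
  unfolding grad_def
  by (intro continuous_intros smooth_continuous_on smooth_frechet_derivative assms)

lemma grad_diff:
  assumes "smooth f" "smooth g"
  shows "grad (\<lambda>x. f x - g x) x = grad f x - grad g x"
proof (rule grad_eqI)
  show "((\<lambda>x. f x - g x) has_derivative
      (\<lambda>v. frechet_derivative f (at x) v - frechet_derivative g (at x) v)) (at x)"
    by (intro has_derivative_diff smooth_has_derivative assms)
qed (simp add: inner_diff_left smooth_grad_inner assms)

lemma grad_restrict:
  assumes "smooth f" "tsupp f \<subseteq> A \<union> B" "open A" "open B" "A \<inter> B = {}"
  shows "grad (\<lambda>x. indicator A x * f x) x = indicator A x *\<^sub>R grad f x"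
  by (rule grad_eqI[OF restrict_has_derivative[OF assms]]) (simp add: smooth_grad_inner assms)

lemma test_fun_restrict:
  assumes "test_fun \<Omega> f" "\<Omega> = A \<union> B" "open A" "open B" "A \<inter> B = {}"
  shows "test_fun A (\<lambda>x. indicator A x * f x)"
proof -
  have f: "smooth f" "compact (tsupp f)" "tsupp f \<subseteq> A \<union> B"
    using assms by (auto simp: test_fun_def)
  \<comment> \<open>Removing the open set \<open>B\<close> leaves a closed set, and since
    \<open>tsupp f\<close> lies in \<open>A \<union> B\<close> what remains lies in
    \<open>A\<close>. Thus the support of the restriction cannot reach the boundary of
    \<open>A\<close>.\<close>
  have "tsupp (\<lambda>x. indicator A x * f x) \<subseteq> tsupp f - B"
  proof (rule tsupp_subset)
    show "closed (tsupp f - B)" by (simp add: assms(4) closed_Diff closed_tsupp)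
    show "x \<in> tsupp f - B" if "indicator A x * f x \<noteq> 0" for x
      using that assms(5) tsupp_eq_0[of x f] by (auto simp: indicator_def split: if_splits)
  qed
  moreover have "compact (tsupp (\<lambda>x. indicator A x * f x))"
    using compact_Int_closed[OF f(2) closed_tsupp[of "\<lambda>x. indicator A x * f x"]] tsupp_restrict[of A f]
    by (simp add: Int_absorb1)
  ultimately show ?thesis
    using smooth_restrict[OF f(1,3) assms(3-5)] f(3) unfolding test_fun_def by auto
qed

lemma test_fun_mono: "test_fun A f \<Longrightarrow> A \<subseteq> B \<Longrightarrow> test_fun B f"
  unfolding test_fun_def by (meson subset_trans)

lemma test_fun_diff:
  assumes "test_fun \<Omega> f" "test_fun \<Omega> g"
  shows "test_fun \<Omega> (\<lambda>x. f x - g x)"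
proof -
  have f: "smooth f" "compact (tsupp f)" "tsupp f \<subseteq> \<Omega>" "smooth g" "compact (tsupp g)" "tsupp g \<subseteq> \<Omega>"
    using assms by (auto simp: test_fun_def)
  have s: "tsupp (\<lambda>x. f x - g x) \<subseteq> tsupp f \<union> tsupp g"
  proof (rule tsupp_subset)
    show "x \<in> tsupp f \<union> tsupp g" if "f x - g x \<noteq> 0" for x
      using that tsupp_eq_0[of x f] tsupp_eq_0[of x g] by fastforce
  qed (intro closed_Un closed_tsupp)
  have "compact (tsupp (\<lambda>x. f x - g x))"
    using compact_Int_closed[OF compact_Un[OF f(2,5)] closed_tsupp[of "\<lambda>x. f x - g x"]] s
    by (simp add: Int_absorb1)
  then show ?thesis
    using smooth_diff[OF f(1,4)] order_trans[OF s Un_least[OF f(3,6)]] unfolding test_fun_def by simp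
qed

section \<open>Square-integrable functions\<close>

text \<open>Vector values are allowed so that the same lemmas serve functions, gradients and the
  difference quotients on the product space.\<close>

definition L2 :: "'x measure \<Rightarrow> ('x \<Rightarrow> 'b::euclidean_space) \<Rightarrow> bool" where
  "L2 M f \<longleftrightarrow> f \<in> borel_measurable M \<and> integrable M (\<lambda>x. (norm (f x))\<^sup>2)"

lemma L2_measurable: "L2 M f \<Longrightarrow> f \<in> borel_measurable M"
  and L2_integrable: "L2 M f \<Longrightarrow> integrable M (\<lambda>x. (norm (f x))\<^sup>2)"
  by (auto simp: L2_def)

lemma L2_inner:
  fixes f g :: "'x \<Rightarrow> 'b::euclidean_space"
  assumes "L2 M f" "L2 M g"
  shows "integrable M (\<lambda>x. f x \<bullet> g x)"
proof (rule Bochner_Integration.integrable_bound)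
  show "integrable M (\<lambda>x. (norm (f x))\<^sup>2 + (norm (g x))\<^sup>2)"
    using assms by (auto simp: L2_def)
  show "(\<lambda>x. f x \<bullet> g x) \<in> borel_measurable M"
    using assms by (auto simp: L2_def)
  have "\<bar>f x \<bullet> g x\<bar> \<le> (norm (f x))\<^sup>2 + (norm (g x))\<^sup>2" for x
    using Cauchy_Schwarz_ineq2[of "f x" "g x"] sum_squares_bound[of "norm (f x)" "norm (g x)"]
      mult_nonneg_nonneg[of "norm (f x)" "norm (g x)"]
    by (simp del: mult_nonneg_nonneg)
  then show "AE x in M. norm (f x \<bullet> g x) \<le> norm ((norm (f x))\<^sup>2 + (norm (g x))\<^sup>2)"
    by simp
qed

lemma L2_scaleR: "L2 M f \<Longrightarrow> L2 M (\<lambda>x. c *\<^sub>R f x)"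
  by (auto simp: L2_def power_mult_distrib)

lemma L2_add:
  assumes "L2 M f" "L2 M g"
  shows "L2 M (\<lambda>x. f x + g x)"
proof -
  have "(norm (f x + g x))\<^sup>2 = (norm (f x))\<^sup>2 + 2 * (f x \<bullet> g x) + (norm (g x))\<^sup>2" for x
    unfolding power2_norm_eq_inner by (simp add: inner_add inner_commute)
  then show ?thesis
    using assms L2_inner[OF assms] by (auto simp: L2_def)
qed

lemma L2_diff: "L2 M f \<Longrightarrow> L2 M g \<Longrightarrow> L2 M (\<lambda>x. f x - g x)"
  using L2_add[of M f "\<lambda>x. (-1) *\<^sub>R g x"] L2_scaleR[of M g "-1"] by simp

lemma L2_indicator:
  assumes "L2 M f" "A \<in> sets M"
  shows "L2 M (\<lambda>x. indicator A x *\<^sub>R f x)"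
proof -
  have "integrable M (\<lambda>x. indicator A x *\<^sub>R (norm (f x))\<^sup>2)"
    by (rule integrable_mult_indicator[OF assms(2) L2_integrable[OF assms(1)]])
  moreover have "indicator A x *\<^sub>R (norm (f x))\<^sup>2 = (norm (indicator A x *\<^sub>R f x))\<^sup>2" for x
    by (simp add: indicator_def)
  ultimately show ?thesis
    using assms by (auto simp: L2_def)
qed

text \<open>The squared norm of \<open>f - t g\<close> is a nonnegative quadratic in
  \<open>t\<close>; its minimiser \<open>?B / ?C\<close> gives the inequality. If
  \<open>?C = 0\<close> the expression is affine in \<open>t\<close>, and
  \<open>t = (?A + 1) / (2 * ?B)\<close> would give it the value -1, so
  \<open>?B = 0\<close>.\<close>

lemma L2_Cauchy_Schwarz:
  assumes "L2 M f" "L2 M g"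
  shows "(\<integral>x. f x \<bullet> g x \<partial>M)\<^sup>2 \<le> (\<integral>x. (norm (f x))\<^sup>2 \<partial>M) * (\<integral>x. (norm (g x))\<^sup>2 \<partial>M)"
    (is "?B\<^sup>2 \<le> ?A * ?C")
proof -
  have I: "integrable M (\<lambda>x. (norm (f x))\<^sup>2)" "integrable M (\<lambda>x. (norm (g x))\<^sup>2)"
    "integrable M (\<lambda>x. f x \<bullet> g x)"
    using assms L2_inner[OF assms] by (auto simp: L2_def)
  have quad: "0 \<le> ?A - 2 * t * ?B + t\<^sup>2 * ?C" for t
  proof -
    have "(norm (f x - t *\<^sub>R g x))\<^sup>2 = (norm (f x))\<^sup>2 - 2 * t * (f x \<bullet> g x) + t\<^sup>2 * (norm (g x))\<^sup>2" for x
      unfolding power2_norm_eq_inner by (simp add: inner_diff inner_commute power2_eq_square algebra_simps)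
    then have "(\<integral>x. (norm (f x - t *\<^sub>R g x))\<^sup>2 \<partial>M) = ?A - 2 * t * ?B + t\<^sup>2 * ?C"
      using I by simp
    moreover have "0 \<le> (\<integral>x. (norm (f x - t *\<^sub>R g x))\<^sup>2 \<partial>M)"
      by (rule integral_nonneg_AE) simp
    ultimately show ?thesis by simp
  qed
  have C: "0 \<le> ?C" by (rule integral_nonneg_AE) simp
  show ?thesis
  proof (cases "?C = 0")
    case True
    show ?thesis
    proof (cases "?B = 0")
      case False
      then show ?thesis
        using quad[of "(?A + 1) / (2 * ?B)"] True by simp
    qed (simp add: True)
  next
    case False
    have "0 \<le> ?A - ?B\<^sup>2 / ?C"
      using quad[of "?B / ?C"] False by (simp add: power2_eq_square divide_simps)
    then show ?thesis
      using False C by (simp add: field_simps)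
  qed
qed

lemma L2_eq_0:
  assumes "L2 M f" "(\<integral>x. (norm (f x))\<^sup>2 \<partial>M) = 0"
  shows "AE x in M. f x = 0"
  using assms integral_nonneg_eq_0_iff_AE[of M "\<lambda>x. (norm (f x))\<^sup>2"] by (simp add: L2_def)

text \<open>Convergence of nonnegative integrals presupposes no integrability of \<open>g\<close>.
  One term at finite distance from \<open>g\<close> already makes \<open>g\<close> square
  integrable, and the limit can then be restated with Bochner integrals.\<close>

lemma L2_limit:
  fixes f :: "nat \<Rightarrow> 'x \<Rightarrow> 'b::euclidean_space"
  assumes f: "\<And>k. L2 M (f k)" and g[measurable]: "g \<in> borel_measurable M"
    and lim: "(\<lambda>k. \<integral>\<^sup>+x. ennreal ((norm (f k x - g x))\<^sup>2) \<partial>M) \<longlonglongrightarrow> 0"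
  shows "L2 M g" "(\<lambda>k. \<integral>x. (norm (f k x - g x))\<^sup>2 \<partial>M) \<longlonglongrightarrow> 0"
proof -
  have [measurable]: "f k \<in> borel_measurable M" for k using f by (simp add: L2_def)
  have "eventually (\<lambda>k. (\<integral>\<^sup>+x. ennreal ((norm (f k x - g x))\<^sup>2) \<partial>M) < 1) sequentially"
    using order_tendstoD(2)[OF lim, of 1] by simp
  then obtain k where "(\<integral>\<^sup>+x. ennreal ((norm (f k x - g x))\<^sup>2) \<partial>M) < 1"
    by (auto simp: eventually_sequentially)
  then have "(\<integral>\<^sup>+x. ennreal (norm ((norm (f k x - g x))\<^sup>2)) \<partial>M) < \<infinity>"
    by (simp add: order.strict_trans)
  then have "integrable M (\<lambda>x. (norm (f k x - g x))\<^sup>2)"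
    by (intro integrableI_bounded) auto
  then have "L2 M (\<lambda>x. f k x - g x)"
    by (auto simp: L2_def)
  from L2_diff[OF f[of k] this] show gL: "L2 M g" by simp
  have "(\<integral>\<^sup>+x. ennreal ((norm (f k x - g x))\<^sup>2) \<partial>M) = ennreal (\<integral>x. (norm (f k x - g x))\<^sup>2 \<partial>M)" for k
    by (rule nn_integral_eq_integral) (use L2_diff[OF f gL] in \<open>auto simp: L2_def\<close>)
  with lim have "(\<lambda>k. ennreal (\<integral>x. (norm (f k x - g x))\<^sup>2 \<partial>M)) \<longlonglongrightarrow> ennreal 0"
    by simp
  then show "(\<lambda>k. \<integral>x. (norm (f k x - g x))\<^sup>2 \<partial>M) \<longlonglongrightarrow> 0"
    by (rule tendsto_ennrealD) (auto intro: integral_nonneg_AE always_eventually)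
qed

lemma L2_inner_tendsto:
  fixes f :: "nat \<Rightarrow> 'x \<Rightarrow> 'b::euclidean_space"
  assumes f: "\<And>k. L2 M (f k)" "L2 M g" "L2 M h"
    and lim: "(\<lambda>k. \<integral>x. (norm (f k x - g x))\<^sup>2 \<partial>M) \<longlonglongrightarrow> 0"
  shows "(\<lambda>k. \<integral>x. h x \<bullet> f k x \<partial>M) \<longlonglongrightarrow> (\<integral>x. h x \<bullet> g x \<partial>M)"
proof (rule LIM_zero_cancel, rule Lim_null_comparison)
  have "(\<lambda>k. sqrt ((\<integral>x. (norm (h x))\<^sup>2 \<partial>M) * (\<integral>x. (norm (f k x - g x))\<^sup>2 \<partial>M)))
      \<longlonglongrightarrow> sqrt ((\<integral>x. (norm (h x))\<^sup>2 \<partial>M) * 0)"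
    by (intro tendsto_intros lim)
  then show "(\<lambda>k. sqrt ((\<integral>x. (norm (h x))\<^sup>2 \<partial>M) * (\<integral>x. (norm (f k x - g x))\<^sup>2 \<partial>M))) \<longlonglongrightarrow> 0"
    by simp
  have "\<bar>(\<integral>x. h x \<bullet> f k x \<partial>M) - (\<integral>x. h x \<bullet> g x \<partial>M)\<bar>
      \<le> sqrt ((\<integral>x. (norm (h x))\<^sup>2 \<partial>M) * (\<integral>x. (norm (f k x - g x))\<^sup>2 \<partial>M))" for k
  proof -
    have "(\<integral>x. h x \<bullet> f k x \<partial>M) - (\<integral>x. h x \<bullet> g x \<partial>M) = (\<integral>x. h x \<bullet> (f k x - g x) \<partial>M)"
      using L2_inner[OF f(3) f(1)] L2_inner[OF f(3) f(2)] by (simp add: inner_diff_right)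
    then show ?thesis
      using L2_Cauchy_Schwarz[OF f(3) L2_diff[OF f(1) f(2)], of k]
      by (simp add: real_le_rsqrt)
  qed
  then show "\<forall>\<^sub>F k in sequentially. norm ((\<integral>x. h x \<bullet> f k x \<partial>M) - (\<integral>x. h x \<bullet> g x \<partial>M))
      \<le> sqrt ((\<integral>x. (norm (h x))\<^sup>2 \<partial>M) * (\<integral>x. (norm (f k x - g x))\<^sup>2 \<partial>M))"
    by simp
qed

lemma L2_continuous_compact_support:
  fixes f :: "'a::euclidean_space \<Rightarrow> 'b::euclidean_space"
  assumes "continuous_on UNIV f" "compact K" "\<And>x. x \<notin> K \<Longrightarrow> f x = 0"
  shows "L2 lebesgue f"
proof -
  have [measurable]: "f \<in> borel_measurable borel"
    by (rule borel_measurable_continuous_onI[OF assms(1)])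
  have fl: "f \<in> borel_measurable lebesgue"
    by (rule borel_measurable_if_lebesgue_on measurable_completion) simp
  have "compact (f ` K)"
    using assms(1,2) compact_continuous_image continuous_on_subset by blast
  then obtain B where B: "\<And>x. x \<in> K \<Longrightarrow> norm (f x) \<le> B"
    by (meson bounded_iff compact_imp_bounded imageI)
  have "integrable lebesgue (\<lambda>x. (norm (f x))\<^sup>2)"
  proof (rule Bochner_Integration.integrable_bound)
    have "integrable lebesgue (indicator K :: 'a \<Rightarrow> real)"
      using assms(2) by (intro integrable_real_indicator)
        (use emeasure_compact_finite[OF assms(2)] in \<open>auto simp: compact_imp_closed\<close>)
    then show "integrable lebesgue (\<lambda>x. B\<^sup>2 * indicator K x)" by simp
    have "(norm (f x))\<^sup>2 \<le> B\<^sup>2 * indicator K x" for x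
      using assms(3) B[of x] by (cases "x \<in> K") (auto intro: power_mono)
    then show "AE x in lebesgue. norm ((norm (f x))\<^sup>2) \<le> norm (B\<^sup>2 * indicator K x)"
      by simp
    show "(\<lambda>x. (norm (f x))\<^sup>2) \<in> borel_measurable lebesgue"
      using fl by measurable
  qed
  with fl show ?thesis by (simp add: L2_def)
qed

lemma test_fun_L2:
  assumes "test_fun \<Omega> f"
  shows "L2 lebesgue f" "L2 lebesgue (grad f)"
proof -
  have f: "smooth f" "compact (tsupp f)"
    using assms by (auto simp: test_fun_def)
  show "L2 lebesgue f"
    by (rule L2_continuous_compact_support[OF smooth_continuous_on f(2)])
      (auto simp: f tsupp_eq_0)
  show "L2 lebesgue (grad f)"
    by (rule L2_continuous_compact_support[OF continuous_on_grad f(2)])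
      (auto simp: f grad_off_tsupp)
qed

section \<open>Translation estimates\<close>

lemma nn_integral_translate:
  fixes f :: "'a::euclidean_space \<Rightarrow> ennreal"
  assumes [measurable]: "f \<in> borel_measurable borel"
  shows "(\<integral>\<^sup>+x. f (x + z) \<partial>lborel) = (\<integral>\<^sup>+x. f x \<partial>lborel)"
proof -
  have "(\<integral>\<^sup>+x. f x \<partial>lborel) = (\<integral>\<^sup>+x. f x \<partial>distr lborel borel ((+) z))"
    by (simp add: lborel_distr_plus)
  also have "\<dots> = (\<integral>\<^sup>+x. f (z + x) \<partial>lborel)"
    by (rule nn_integral_distr) measurable
  finally show ?thesis by (simp add: add.commute)
qed

lemma smooth_has_line_derivative:
  assumes "smooth f"
  shows "((\<lambda>t. f (x + t *\<^sub>R v)) has_real_derivative frechet_derivative f (at (x + t *\<^sub>R v)) v) (at t)"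
proof -
  have "((\<lambda>t. x + t *\<^sub>R v) has_derivative (\<lambda>r. r *\<^sub>R v)) (at t)"
    by (auto intro!: derivative_eq_intros)
  from has_derivative_compose[OF this smooth_has_derivative[OF assms]]
  have "((\<lambda>t. f (x + t *\<^sub>R v)) has_derivative
      (\<lambda>r. frechet_derivative f (at (x + t *\<^sub>R v)) (r *\<^sub>R v))) (at t)" .
  moreover have "frechet_derivative f (at (x + t *\<^sub>R v)) (r *\<^sub>R v)
      = frechet_derivative f (at (x + t *\<^sub>R v)) v * r" for r
    by (simp add: smooth_grad_inner[OF assms, symmetric])
  ultimately show ?thesis
    by (simp add: has_field_derivative_def)
qed

text \<open>The fundamental theorem of calculus along the segment writes the increment as an
  integral over \<open>{0..1}\<close>; Cauchy-Schwarz against the indicator of that interval, which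
  has norm 1, bounds its square.\<close>

lemma segment_increment_bound:
  fixes f :: "'a::euclidean_space \<Rightarrow> real"
  assumes "smooth f"
  shows "ennreal ((f (x + z) - f x)\<^sup>2)
    \<le> (\<integral>\<^sup>+t. ennreal ((norm z)\<^sup>2 * (norm (grad f (x + t *\<^sub>R z)))\<^sup>2) * indicator {0..1} t \<partial>lborel)"
proof -
  define h where "h t = grad f (x + t *\<^sub>R z) \<bullet> z" for t
  have hc: "continuous_on S h" for S
    unfolding h_def
    by (intro continuous_intros continuous_on_compose2[OF continuous_on_grad[OF assms, of UNIV]]) auto
  have [measurable]: "h \<in> borel_measurable borel"
    by (rule borel_measurable_continuous_onI[OF hc])
  have D: "((\<lambda>t. f (x + t *\<^sub>R z)) has_real_derivative h t) (at t within S)" for t S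
    unfolding h_def smooth_grad_inner[OF assms]
    by (rule has_field_derivative_at_within[OF smooth_has_line_derivative[OF assms]])
  have FTC: "(\<integral>t. indicator {0..1} t *\<^sub>R h t \<partial>lborel) = f (x + 1 *\<^sub>R z) - f (x + 0 *\<^sub>R z)"
    by (rule integral_FTC_Icc) (auto intro: hc D[unfolded has_real_derivative_iff_has_vector_derivative])
  have int2: "integrable lborel (\<lambda>t. indicator {0..1} t *\<^sub>R (h t)\<^sup>2)"
    by (rule borel_integrable_compact) (auto intro: continuous_intros hc)
  have L: "L2 lborel (\<lambda>t. indicator {0..1::real} t :: real)"
    "L2 lborel (\<lambda>t. indicator {0..1} t *\<^sub>R h t)"
  proof -
    have "(norm (indicator {0..1::real} t :: real))\<^sup>2 = indicator {0..1} t" for t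
      by (simp add: indicator_def)
    then show "L2 lborel (\<lambda>t. indicator {0..1::real} t :: real)"
      by (simp add: L2_def)
    have "(norm (indicator {0..1::real} t *\<^sub>R h t))\<^sup>2 = indicator {0..1} t *\<^sub>R (h t)\<^sup>2" for t
      by (simp add: indicator_def)
    then show "L2 lborel (\<lambda>t. indicator {0..1} t *\<^sub>R h t)"
      using int2 by (simp add: L2_def)
  qed
  have e1: "(\<lambda>t. indicator {0..1::real} t \<bullet> (indicator {0..1} t *\<^sub>R h t)) = (\<lambda>t. indicator {0..1} t *\<^sub>R h t)"
    by (auto simp: indicator_def)
  have e2: "(\<integral>t. (norm (indicator {0..1::real} t :: real))\<^sup>2 \<partial>lborel) = 1"
  proof -
    have "(norm (indicator {0..1::real} t :: real))\<^sup>2 = indicator {0..1} t" for t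
      by (simp add: indicator_def)
    then show ?thesis by simp
  qed
  have e3: "(\<lambda>t. (norm (indicator {0..1::real} t *\<^sub>R h t))\<^sup>2) = (\<lambda>t. indicator {0..1} t *\<^sub>R (h t)\<^sup>2)"
    by (auto simp: indicator_def)
  have "(f (x + z) - f x)\<^sup>2 \<le> (\<integral>t. indicator {0..1} t *\<^sub>R (h t)\<^sup>2 \<partial>lborel)"
    using L2_Cauchy_Schwarz[OF L] unfolding e1 e2 e3 FTC by simp
  then have "ennreal ((f (x + z) - f x)\<^sup>2) \<le> ennreal (\<integral>t. indicator {0..1} t *\<^sub>R (h t)\<^sup>2 \<partial>lborel)"
    by (rule ennreal_leI)
  also have "\<dots> = (\<integral>\<^sup>+t. ennreal (indicator {0..1} t *\<^sub>R (h t)\<^sup>2) \<partial>lborel)"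
    by (rule nn_integral_eq_integral[symmetric, OF int2]) auto
  also have "\<dots> \<le> (\<integral>\<^sup>+t. ennreal ((norm z)\<^sup>2 * (norm (grad f (x + t *\<^sub>R z)))\<^sup>2) * indicator {0..1} t \<partial>lborel)"
  proof (rule nn_integral_mono)
    fix t
    have "(h t)\<^sup>2 \<le> (norm z)\<^sup>2 * (norm (grad f (x + t *\<^sub>R z)))\<^sup>2"
      using Cauchy_Schwarz_ineq[of "grad f (x + t *\<^sub>R z)" z]
      by (simp add: h_def power2_norm_eq_inner mult.commute)
    then show "ennreal (indicator {0..1} t *\<^sub>R (h t)\<^sup>2)
        \<le> ennreal ((norm z)\<^sup>2 * (norm (grad f (x + t *\<^sub>R z)))\<^sup>2) * indicator {0..1} t"
      by (auto simp: indicator_def intro: ennreal_leI)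
  qed
  finally show ?thesis .
qed

lemma smooth_borel_measurable: "smooth f \<Longrightarrow> f \<in> borel_measurable borel"
  by (rule borel_measurable_continuous_onI[OF smooth_continuous_on])

lemma grad_borel_measurable: "smooth f \<Longrightarrow> grad f \<in> borel_measurable borel"
  by (rule borel_measurable_continuous_onI[OF continuous_on_grad])

text \<open>After integrating the segment bound over \<open>x\<close> and exchanging the integrals,
  translation invariance makes every \<open>t\<close> contribute the same amount, and
  \<open>{0..1}\<close> has length 1.\<close>

lemma smooth_translation_bound:
  fixes f :: "'a::euclidean_space \<Rightarrow> real"
  assumes "smooth f"
  shows "(\<integral>\<^sup>+x. ennreal ((f (x + z) - f x)\<^sup>2) \<partial>lborel)
    \<le> ennreal ((norm z)\<^sup>2) * (\<integral>\<^sup>+x. ennreal ((norm (grad f x))\<^sup>2) \<partial>lborel)"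
proof -
  note [measurable] = smooth_borel_measurable[OF assms] grad_borel_measurable[OF assms]
  have "(\<integral>\<^sup>+x. ennreal ((f (x + z) - f x)\<^sup>2) \<partial>lborel)
     \<le> (\<integral>\<^sup>+x. \<integral>\<^sup>+t. ennreal ((norm z)\<^sup>2 * (norm (grad f (x + t *\<^sub>R z)))\<^sup>2) * indicator {0..1::real} t \<partial>lborel \<partial>lborel)"
    by (intro nn_integral_mono segment_increment_bound assms)
  also have "\<dots> = (\<integral>\<^sup>+t. \<integral>\<^sup>+x. ennreal ((norm z)\<^sup>2 * (norm (grad f (x + t *\<^sub>R z)))\<^sup>2) * indicator {0..1::real} t \<partial>lborel \<partial>lborel)"
    by (rule lborel_pair.Fubini'[symmetric]) measurable
  also have "\<dots> = (\<integral>\<^sup>+t. (\<integral>\<^sup>+x. ennreal ((norm z)\<^sup>2 * (norm (grad f x))\<^sup>2) \<partial>lborel) * indicator {0..1::real} t \<partial>lborel)"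
    by (subst nn_integral_multc)
      (auto simp: nn_integral_translate[of "\<lambda>x. ennreal ((norm z)\<^sup>2 * (norm (grad f x))\<^sup>2)"])
  also have "\<dots> = (\<integral>\<^sup>+x. ennreal ((norm z)\<^sup>2 * (norm (grad f x))\<^sup>2) \<partial>lborel)"
    by (simp add: nn_integral_cmult)
  also have "\<dots> = ennreal ((norm z)\<^sup>2) * (\<integral>\<^sup>+x. ennreal ((norm (grad f x))\<^sup>2) \<partial>lborel)"
    by (simp add: ennreal_mult nn_integral_cmult)
  finally show ?thesis .
qed

section \<open>Sobolev functions as limits of test functions, and their translates\<close>

lemma H10_gradE:
  assumes "H10_grad \<Omega> u G"
  obtains \<phi> where "\<And>k. test_fun \<Omega> (\<phi> k)" "L2 lebesgue u" "L2 lebesgue G"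
    "(\<lambda>k. \<integral>x. (norm (\<phi> k x - u x))\<^sup>2 \<partial>lebesgue) \<longlonglongrightarrow> 0"
    "(\<lambda>k. \<integral>x. (norm (grad (\<phi> k) x - G x))\<^sup>2 \<partial>lebesgue) \<longlonglongrightarrow> 0"
proof -
  obtain \<phi> where \<phi>: "\<And>k. test_fun \<Omega> (\<phi> k)"
    and l: "(\<lambda>k. \<integral>\<^sup>+x. ennreal ((norm (\<phi> k x - u x))\<^sup>2) \<partial>lebesgue) \<longlonglongrightarrow> 0"
      "(\<lambda>k. \<integral>\<^sup>+x. ennreal ((norm (grad (\<phi> k) x - G x))\<^sup>2) \<partial>lebesgue) \<longlonglongrightarrow> 0"
    and m: "u \<in> borel_measurable lebesgue" "G \<in> borel_measurable lebesgue"
    using assms unfolding H10_grad_def by (auto simp: power2_abs)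
  show ?thesis
    using that[OF \<phi> L2_limit(1)[OF test_fun_L2(1)[OF \<phi>] m(1) l(1)] L2_limit(1)[OF test_fun_L2(2)[OF \<phi>] m(2) l(2)]
       L2_limit(2)[OF test_fun_L2(1)[OF \<phi>] m(1) l(1)] L2_limit(2)[OF test_fun_L2(2)[OF \<phi>] m(2) l(2)]] .
qed

lemma H10_gradI:
  assumes "\<And>k. test_fun \<Omega> (\<phi> k)" "L2 lebesgue u" "L2 lebesgue G"
    and l: "(\<lambda>k. \<integral>x. (norm (\<phi> k x - u x))\<^sup>2 \<partial>lebesgue) \<longlonglongrightarrow> 0"
    "(\<lambda>k. \<integral>x. (norm (grad (\<phi> k) x - G x))\<^sup>2 \<partial>lebesgue) \<longlonglongrightarrow> 0"
  shows "H10_grad \<Omega> u G"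
proof -
  have "(\<integral>\<^sup>+x. ennreal ((\<phi> k x - u x)\<^sup>2) \<partial>lebesgue) = ennreal (\<integral>x. (norm (\<phi> k x - u x))\<^sup>2 \<partial>lebesgue)" for k
    using L2_integrable[OF L2_diff[OF test_fun_L2(1)[OF assms(1)] assms(2)]]
    by (subst nn_integral_eq_integral[symmetric]) auto
  moreover have "(\<integral>\<^sup>+x. ennreal ((norm (grad (\<phi> k) x - G x))\<^sup>2) \<partial>lebesgue)
      = ennreal (\<integral>x. (norm (grad (\<phi> k) x - G x))\<^sup>2 \<partial>lebesgue)" for k
    using L2_integrable[OF L2_diff[OF test_fun_L2(2)[OF assms(1)] assms(3)]]
    by (subst nn_integral_eq_integral[symmetric]) auto
  ultimately have "(\<lambda>k. \<integral>\<^sup>+x. ennreal ((\<phi> k x - u x)\<^sup>2) \<partial>lebesgue) \<longlonglongrightarrow> 0"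
    "(\<lambda>k. \<integral>\<^sup>+x. ennreal ((norm (grad (\<phi> k) x - G x))\<^sup>2) \<partial>lebesgue) \<longlonglongrightarrow> 0"
    using tendsto_ennrealI[OF l(1)] tendsto_ennrealI[OF l(2)] by simp_all
  then show ?thesis
    unfolding H10_grad_def using assms(1) L2_measurable[OF assms(2)] L2_measurable[OF assms(3)] by blast
qed

text \<open>Needed for Fubini on the product \<open>lebesgue \<Otimes>\<^sub>M lebesgue\<close> that
  occurs in \<open>frac_form\<close>; the countable cover is inherited from
  \<open>lborel\<close>.\<close>

lemma sigma_finite_lebesgue: "sigma_finite_measure (lebesgue :: 'a::euclidean_space measure)"
proof
  obtain A :: "'a set set" where A: "countable A" "A \<subseteq> sets lborel" "\<Union>A = space lborel"
    "\<forall>a\<in>A. emeasure lborel a \<noteq> \<infinity>"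
    using lborel.sigma_finite_countable by blast
  have "emeasure lebesgue a = emeasure lborel a" if "a \<in> A" for a
    using that A(2) by (metis emeasure_completion main_part sets_completionI_sets subsetD)
  then show "\<exists>A::'a set set. countable A \<and> A \<subseteq> sets lebesgue \<and> \<Union>A = space lebesgue
      \<and> (\<forall>a\<in>A. emeasure lebesgue a \<noteq> \<infinity>)"
    using A by (intro exI[of _ A]) auto
qed

interpretation leb: sigma_finite_measure "lebesgue :: 'a::euclidean_space measure"
  by (rule sigma_finite_lebesgue)

interpretation leb_pair: pair_sigma_finite "lebesgue :: 'a::euclidean_space measure" "lebesgue :: 'b::euclidean_space measure"
  by (simp add: pair_sigma_finite_def sigma_finite_lebesgue)

text \<open>For a merely Lebesgue measurable \<open>u\<close> the map \<open>(x, z) \<mapsto> u (x + z)\<close> need not be measurable with respect to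
the product of the completed measures; Tonelli arguments with translations use a Borel version.\<close>

lemma borel_representative:
  fixes u :: "'a::euclidean_space \<Rightarrow> real"
  assumes "u \<in> borel_measurable lebesgue"
  obtains u' where "u' \<in> borel_measurable borel" "AE x in lebesgue. u x = u' x"
proof -
  obtain u' where "u' \<in> borel_measurable lborel" "AE x in lborel. u x = u' x"
    using completion_ex_borel_measurable_real[OF assms] by blast
  then show ?thesis
    using that[of u'] AE_completion by auto
qed

text \<open>The constant \<open>6\<close> is not optimal; it absorbs the approximation errors by test functions.\<close>

lemma H10_grad_translation_bound:
  fixes u :: "'a::euclidean_space \<Rightarrow> real"
  assumes "H10_grad \<Omega> u G" and [measurable]: "u' \<in> borel_measurable borel"
    and ae: "AE x in lebesgue. u x = u' x"
  shows "(\<integral>\<^sup>+x. ennreal ((u' (x + z) - u' x)\<^sup>2) \<partial>lborel)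
    \<le> ennreal (6 * (\<integral>x. (norm (G x))\<^sup>2 \<partial>lebesgue) * (norm z)\<^sup>2)"
proof -
  obtain \<phi> where \<phi>: "\<And>k. test_fun \<Omega> (\<phi> k)" "L2 lebesgue u" "L2 lebesgue G"
    and lim: "(\<lambda>k. \<integral>x. (norm (\<phi> k x - u x))\<^sup>2 \<partial>lebesgue) \<longlonglongrightarrow> 0"
    "(\<lambda>k. \<integral>x. (norm (grad (\<phi> k) x - G x))\<^sup>2 \<partial>lebesgue) \<longlonglongrightarrow> 0"
    by (rule H10_gradE[OF assms(1)]) (rule that)
  define e where "e k = (\<integral>x. (norm (\<phi> k x - u x))\<^sup>2 \<partial>lebesgue)" for k
  define d where "d k = (\<integral>x. (norm (grad (\<phi> k) x - G x))\<^sup>2 \<partial>lebesgue)" for k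
  define g where "g = (\<integral>x. (norm (G x))\<^sup>2 \<partial>lebesgue)"
  have pos: "0 \<le> e k" "0 \<le> d k" "0 \<le> g" for k
    by (auto simp: e_def d_def g_def intro: integral_nonneg_AE)
  have bound: "(\<integral>\<^sup>+x. ennreal ((u' (x + z) - u' x)\<^sup>2) \<partial>lborel)
    \<le> ennreal (6 * e k + 6 * (norm z)\<^sup>2 * (g + d k))" for k
  proof -
    have sm: "smooth (\<phi> k)" using \<phi>(1) by (auto simp: test_fun_def)
    note [measurable] = smooth_borel_measurable[OF sm] grad_borel_measurable[OF sm]
    define a where "a x = ennreal ((\<phi> k x - u' x)\<^sup>2)" for x
    have [measurable]: "a \<in> borel_measurable borel" unfolding a_def by measurable
    have ea: "(\<integral>\<^sup>+x. a x \<partial>lborel) = ennreal (e k)"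
    proof -
      have "(\<integral>\<^sup>+x. a x \<partial>lborel) = (\<integral>\<^sup>+x. a x \<partial>lebesgue)"
        by (simp add: nn_integral_completion)
      also have "\<dots> = (\<integral>\<^sup>+x. ennreal ((norm (\<phi> k x - u x))\<^sup>2) \<partial>lebesgue)"
        unfolding a_def by (rule nn_integral_cong_AE) (use ae in eventually_elim, simp)
      also have "\<dots> = ennreal (e k)"
        unfolding e_def
        by (rule nn_integral_eq_integral[OF L2_integrable[OF L2_diff[OF test_fun_L2(1)[OF \<phi>(1)] \<phi>(2)]]]) simp
      finally show ?thesis .
    qed
    have eg: "(\<integral>\<^sup>+x. ennreal ((norm (grad (\<phi> k) x))\<^sup>2) \<partial>lborel) \<le> ennreal (2 * g + 2 * d k)"
    proof -
      have "(\<integral>\<^sup>+x. ennreal ((norm (grad (\<phi> k) x))\<^sup>2) \<partial>lborel)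
          = ennreal (\<integral>x. (norm (grad (\<phi> k) x))\<^sup>2 \<partial>lebesgue)"
        unfolding nn_integral_completion[symmetric, of lborel]
        by (rule nn_integral_eq_integral[OF L2_integrable[OF test_fun_L2(2)[OF \<phi>(1)]]]) simp
      also have "(\<integral>x. (norm (grad (\<phi> k) x))\<^sup>2 \<partial>lebesgue)
          \<le> (\<integral>x. 2 * (norm (G x))\<^sup>2 + 2 * (norm (grad (\<phi> k) x - G x))\<^sup>2 \<partial>lebesgue)"
      proof (rule integral_mono)
        show "integrable lebesgue (\<lambda>x. (norm (grad (\<phi> k) x))\<^sup>2)"
          by (rule L2_integrable[OF test_fun_L2(2)[OF \<phi>(1)]])
        show "integrable lebesgue (\<lambda>x. 2 * (norm (G x))\<^sup>2 + 2 * (norm (grad (\<phi> k) x - G x))\<^sup>2)"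
          using L2_integrable[OF L2_diff[OF test_fun_L2(2)[OF \<phi>(1)] \<phi>(3)]] L2_integrable[OF \<phi>(3)]
          by simp
        show "(norm (grad (\<phi> k) x))\<^sup>2 \<le> 2 * (norm (G x))\<^sup>2 + 2 * (norm (grad (\<phi> k) x - G x))\<^sup>2" for x
        proof -
          have "norm (grad (\<phi> k) x) \<le> norm (G x) + norm (grad (\<phi> k) x - G x)"
            by (metis add.commute diff_add_cancel norm_triangle_ineq)
          then have "(norm (grad (\<phi> k) x))\<^sup>2 \<le> (norm (G x) + norm (grad (\<phi> k) x - G x))\<^sup>2"
            by (intro power_mono) auto
          then show ?thesis
            using sum_squares_bound[of "norm (G x)" "norm (grad (\<phi> k) x - G x)"]
            by (simp add: power2_sum)
        qed
      qed
      also have "\<dots> = 2 * g + 2 * d k"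
        using L2_integrable[OF L2_diff[OF test_fun_L2(2)[OF \<phi>(1)] \<phi>(3)]] L2_integrable[OF \<phi>(3)]
        by (simp add: g_def d_def)
      finally show ?thesis by (simp add: ennreal_leI)
    qed
    \<comment> \<open>The increment is split into an error at \<open>x + z\<close>, an increment of
      \<open>\<phi> k\<close> and an error at \<open>x\<close>, at the cost of a factor 3. Together
      with the factor 2 in \<open>eg\<close> this makes the 6.\<close>
    have "(\<integral>\<^sup>+x. ennreal ((u' (x + z) - u' x)\<^sup>2) \<partial>lborel)
       \<le> (\<integral>\<^sup>+x. 3 * (a (x + z) + ennreal ((\<phi> k (x + z) - \<phi> k x)\<^sup>2) + a x) \<partial>lborel)"
    proof (rule nn_integral_mono)
      fix x
      have "(p + q + r)\<^sup>2 \<le> 3 * (p\<^sup>2 + q\<^sup>2 + r\<^sup>2)" for p q r :: real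
        using sum_squares_bound[of p q] sum_squares_bound[of p r] sum_squares_bound[of q r]
        by (simp add: power2_eq_square algebra_simps)
      from this[of "u' (x + z) - \<phi> k (x + z)" "\<phi> k (x + z) - \<phi> k x" "\<phi> k x - u' x"]
      have "(u' (x + z) - u' x)\<^sup>2
        \<le> 3 * ((\<phi> k (x + z) - u' (x + z))\<^sup>2 + (\<phi> k (x + z) - \<phi> k x)\<^sup>2 + (\<phi> k x - u' x)\<^sup>2)"
        by (simp add: power2_commute)
      then have "ennreal ((u' (x + z) - u' x)\<^sup>2)
        \<le> ennreal (3 * ((\<phi> k (x + z) - u' (x + z))\<^sup>2 + (\<phi> k (x + z) - \<phi> k x)\<^sup>2 + (\<phi> k x - u' x)\<^sup>2))"
        by (rule ennreal_leI)
      also have "\<dots> = 3 * (a (x + z) + ennreal ((\<phi> k (x + z) - \<phi> k x)\<^sup>2) + a x)"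
        unfolding a_def by (subst ennreal_mult) auto
      finally show "ennreal ((u' (x + z) - u' x)\<^sup>2)
        \<le> 3 * (a (x + z) + ennreal ((\<phi> k (x + z) - \<phi> k x)\<^sup>2) + a x)" .
    qed
    also have "\<dots> = 3 * ((\<integral>\<^sup>+x. a (x + z) \<partial>lborel) + (\<integral>\<^sup>+x. ennreal ((\<phi> k (x + z) - \<phi> k x)\<^sup>2) \<partial>lborel) + (\<integral>\<^sup>+x. a x \<partial>lborel))"
      by (simp add: nn_integral_cmult nn_integral_add)
    also have "\<dots> \<le> 3 * (ennreal (e k) + ennreal ((norm z)\<^sup>2) * ennreal (2 * g + 2 * d k) + ennreal (e k))"
      unfolding nn_integral_translate[OF \<open>a \<in> borel_measurable borel\<close>] ea
      by (intro mult_left_mono add_mono order_refl order_trans[OF smooth_translation_bound[OF sm]] eg) auto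
    also have "\<dots> = ennreal (3 * (e k + (norm z)\<^sup>2 * (2 * g + 2 * d k) + e k))"
    proof -
      have tri: "3 * (ennreal A + ennreal B * ennreal C + ennreal A) = ennreal (3 * (A + B * C + A))"
        if "0 \<le> A" "0 \<le> B" "0 \<le> C" for A B C
      proof -
        have "ennreal A + ennreal B * ennreal C + ennreal A = ennreal (A + B * C + A)"
          using that by (simp add: ennreal_mult[symmetric] flip: ennreal_plus)
        then show ?thesis using that by (subst ennreal_mult) auto
      qed
      show ?thesis by (rule tri) (use pos in auto)
    qed
    also have "3 * (e k + (norm z)\<^sup>2 * (2 * g + 2 * d k) + e k) = 6 * e k + 6 * (norm z)\<^sup>2 * (g + d k)"
      by (simp add: algebra_simps)
    finally show ?thesis .
  qed
  have "(\<lambda>k. 6 * e k + 6 * (norm z)\<^sup>2 * (g + d k)) \<longlonglongrightarrow> 6 * 0 + 6 * (norm z)\<^sup>2 * (g + 0)"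
    using lim unfolding e_def d_def by (intro tendsto_intros)
  then have "(\<lambda>k. ennreal (6 * e k + 6 * (norm z)\<^sup>2 * (g + d k))) \<longlonglongrightarrow> ennreal (6 * 0 + 6 * (norm z)\<^sup>2 * (g + 0))"
    by (rule tendsto_ennrealI)
  then have "(\<integral>\<^sup>+x. ennreal ((u' (x + z) - u' x)\<^sup>2) \<partial>lborel) \<le> ennreal (6 * 0 + 6 * (norm z)\<^sup>2 * (g + 0))"
    by (rule tendsto_lowerbound) (use bound in auto)
  then show ?thesis
    by (simp add: g_def mult_ac)
qed

lemma powr_layer_cake:
  assumes "0 < r" "0 < a"
  shows "(\<integral>\<^sup>+t. ennreal (a * t powr (- a - 1)) * indicator {r..} t \<partial>lborel) = ennreal (r powr (- a))"
proof -
  have "(\<integral>\<^sup>+t. ennreal (a * t powr (- a - 1)) * indicator {r..} t \<partial>lborel) = 0 - (- (r powr (- a)))"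
  proof (rule nn_integral_FTC_atLeast)
    show "((\<lambda>t. - (t powr (- a))) has_real_derivative a * t powr (- a - 1)) (at t)" if "r \<le> t" for t
      using that assms by (auto intro!: derivative_eq_intros simp: field_simps)
    have "((\<lambda>t::real. t powr (- a)) \<longlongrightarrow> 0) at_top"
      using tendsto_neg_powr[of "- a" "\<lambda>t. t" at_top] assms filterlim_ident by auto
    from tendsto_minus[OF this] show "((\<lambda>t. - (t powr (- a))) \<longlongrightarrow> 0) at_top" by simp
  qed (use assms in auto)
  then show ?thesis by simp
qed

lemma nn_integral_powr_unit_interval:
  assumes "-1 < a"
  shows "(\<integral>\<^sup>+t. ennreal (t powr a) * indicator {0..1} t \<partial>lborel) = ennreal (1 / (a + 1))"
proof -
  have "((\<lambda>t. t powr a) has_integral (1 powr (a + 1) / (a + 1))) {0..1::real}"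
    by (rule has_integral_powr_from_0[OF assms]) simp
  then have "((\<lambda>t. if t \<in> {0..1} then t powr a else 0) has_integral (1 / (a + 1))) UNIV"
    by (simp only: has_integral_restrict_UNIV) simp
  then have "((\<lambda>t. t powr a * indicator {0..1} t) has_integral (1 / (a + 1))) UNIV"
    by (rule has_integral_eq[rotated]) (auto simp: indicator_def)
  then have "integral\<^sup>N lborel (\<lambda>t. ennreal (t powr a * indicator {0..1} t)) = ennreal (1 / (a + 1))"
    by (intro nn_integral_has_integral_lborel) auto
  then show ?thesis
    by (simp add: ennreal_mult ennreal_indicator)
qed

section \<open>The Gagliardo seminorm\<close>

text \<open>Writing \<open>|z|\<close> to the power \<open>-a\<close> as \<open>\<integral> a t\<close> to the power \<open>-a-1\<close> over \<open>t \<ge> |z|\<close> reduces the double integral to the volume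
of balls and the \<open>L\<^sup>2\<close> modulus of continuity; the gradient controls \<open>t \<le> 1\<close> and the mass controls \<open>t \<ge> 1\<close>.\<close>

lemma gagliardo_bound:
  fixes u :: "'a::euclidean_space \<Rightarrow> real"
  assumes [measurable]: "u \<in> borel_measurable borel" and s: "0 < s" "s < 1" and E: "0 \<le> E" and L: "0 \<le> L"
    and trans: "\<And>z. (\<integral>\<^sup>+x. ennreal ((u (x + z) - u x)\<^sup>2) \<partial>lborel) \<le> ennreal (E * (norm z)\<^sup>2)"
    and mass: "(\<integral>\<^sup>+x. ennreal ((u x)\<^sup>2) \<partial>lborel) \<le> ennreal L"
  shows "(\<integral>\<^sup>+x. \<integral>\<^sup>+y. ennreal ((u x - u y)\<^sup>2 / norm (x - y) powr (real DIM('a) + 2 * s)) \<partial>lborel \<partial>lborel)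
    \<le> ennreal (unit_ball_vol (real DIM('a)) * (real DIM('a) + 2 * s) * (E / (2 - 2 * s) + 4 * L / (2 * s)))"
proof -
  define a where "a = real DIM('a) + 2 * s"
  have a: "0 < a" using s by (simp add: a_def)
  define \<omega> where "\<omega> = unit_ball_vol (real DIM('a))"
  have \<omega>: "0 \<le> \<omega>" by (simp add: \<omega>_def)
  define c where "c z t = (if norm z \<le> t then ennreal (a * t powr (- a - 1)) else 0)" for z :: 'a and t :: real
  define k where "k z = (\<integral>\<^sup>+t. c z t \<partial>lborel)" for z
  define w where "w z = (\<integral>\<^sup>+x. ennreal ((u (x + z) - u x)\<^sup>2) \<partial>lborel)" for z
  have [measurable]: "(\<lambda>(z, t). c z t) \<in> borel_measurable (borel \<Otimes>\<^sub>M borel)"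
    unfolding c_def by measurable
  have [measurable]: "k \<in> borel_measurable borel" "w \<in> borel_measurable borel"
    unfolding k_def w_def by measurable
  have w2: "w z \<le> ennreal (4 * L)" for z
  proof -
    have "w z \<le> (\<integral>\<^sup>+x. 2 * ennreal ((u (x + z))\<^sup>2) + 2 * ennreal ((u x)\<^sup>2) \<partial>lborel)"
      unfolding w_def
    proof (rule nn_integral_mono)
      fix x
      have "(u (x + z) - u x)\<^sup>2 \<le> 2 * (u (x + z))\<^sup>2 + 2 * (u x)\<^sup>2"
        using sum_squares_bound[of "u (x + z)" "- u x"] by (simp add: power2_diff)
      then have "ennreal ((u (x + z) - u x)\<^sup>2) \<le> ennreal (2 * (u (x + z))\<^sup>2 + 2 * (u x)\<^sup>2)"
        by (rule ennreal_leI)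
      then show "ennreal ((u (x + z) - u x)\<^sup>2) \<le> 2 * ennreal ((u (x + z))\<^sup>2) + 2 * ennreal ((u x)\<^sup>2)"
        by (simp add: ennreal_mult)
    qed
    also have "\<dots> = 2 * (\<integral>\<^sup>+x. ennreal ((u (x + z))\<^sup>2) \<partial>lborel) + 2 * (\<integral>\<^sup>+x. ennreal ((u x)\<^sup>2) \<partial>lborel)"
      by (simp add: nn_integral_add nn_integral_cmult)
    also have "\<dots> \<le> 2 * ennreal L + 2 * ennreal L"
      using nn_integral_translate[of "\<lambda>x. ennreal ((u x)\<^sup>2)" z] mass
      by (intro add_mono mult_left_mono) auto
    also have "\<dots> = ennreal (4 * L)"
      using L by (simp add: ennreal_mult flip: distrib_right)
    finally show ?thesis .
  qed
  have "(\<integral>\<^sup>+x. \<integral>\<^sup>+y. ennreal ((u x - u y)\<^sup>2 / norm (x - y) powr a) \<partial>lborel \<partial>lborel)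
      = (\<integral>\<^sup>+x. \<integral>\<^sup>+z. ennreal ((u (x + z) - u x)\<^sup>2) * k z \<partial>lborel \<partial>lborel)"
  proof (rule nn_integral_cong)
    fix x :: 'a
    have "(\<integral>\<^sup>+y. ennreal ((u x - u y)\<^sup>2 / norm (x - y) powr a) \<partial>lborel)
        = (\<integral>\<^sup>+z. ennreal ((u x - u (z + x))\<^sup>2 / norm (x - (z + x)) powr a) \<partial>lborel)"
      by (rule nn_integral_translate[symmetric]) measurable
    also have "\<dots> = (\<integral>\<^sup>+z. ennreal ((u (x + z) - u x)\<^sup>2) * k z \<partial>lborel)"
    proof (rule nn_integral_cong)
      fix z :: 'a
      show "ennreal ((u x - u (z + x))\<^sup>2 / norm (x - (z + x)) powr a) = ennreal ((u (x + z) - u x)\<^sup>2) * k z"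
      \<comment> \<open>At \<open>z = 0\<close> the weight \<open>k z\<close> is infinite, but it
        multiplies an increment that is zero.\<close>
      proof (cases "z = 0")
        case False
        have "k z = (\<integral>\<^sup>+t. ennreal (a * t powr (- a - 1)) * indicator {norm z..} t \<partial>lborel)"
          unfolding k_def c_def by (rule nn_integral_cong) (simp add: indicator_def)
        also have "\<dots> = ennreal (norm z powr (- a))"
          by (rule powr_layer_cake) (use False a in auto)
        finally show ?thesis
          by (simp add: ennreal_mult[symmetric] powr_minus_divide add.commute power2_commute[of "u x"])
      qed simp
    qed
    finally show "(\<integral>\<^sup>+y. ennreal ((u x - u y)\<^sup>2 / norm (x - y) powr a) \<partial>lborel)
        = (\<integral>\<^sup>+z. ennreal ((u (x + z) - u x)\<^sup>2) * k z \<partial>lborel)" .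
  qed
  also have "\<dots> = (\<integral>\<^sup>+z. \<integral>\<^sup>+x. ennreal ((u (x + z) - u x)\<^sup>2) * k z \<partial>lborel \<partial>lborel)"
    by (rule lborel_pair.Fubini'[symmetric]) measurable
  also have "\<dots> = (\<integral>\<^sup>+z. w z * k z \<partial>lborel)"
    by (simp add: w_def nn_integral_multc)
  also have "\<dots> = (\<integral>\<^sup>+z. \<integral>\<^sup>+t. w z * c z t \<partial>lborel \<partial>lborel)"
    unfolding k_def by (intro nn_integral_cong nn_integral_cmult[symmetric]) measurable
  also have "\<dots> = (\<integral>\<^sup>+t. \<integral>\<^sup>+z. w z * c z t \<partial>lborel \<partial>lborel)"
    by (rule lborel_pair.Fubini'[symmetric]) measurable
  also have "\<dots> \<le> (\<integral>\<^sup>+t. ennreal (\<omega> * a * E) * (ennreal (t powr (1 - 2 * s)) * indicator {0..1} t)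
      + ennreal (\<omega> * a * (4 * L / (2 * s))) * (ennreal (2 * s * t powr (- (2 * s) - 1)) * indicator {1..} t) \<partial>lborel)"
  proof (rule nn_integral_mono)
    fix t :: real
    \<comment> \<open>The volume of the ball of radius \<open>t\<close> cancels the dimension
      contained in \<open>a\<close>. The remaining power \<open>- 2 * s - 1\<close> is integrable at
      infinity, and near 0 once \<open>B\<close> supplies a factor \<open>t\<close> squared.\<close>
    have slice: "(\<integral>\<^sup>+z. w z * c z t \<partial>lborel) \<le> ennreal (\<omega> * a * B * t powr (- 2 * s - 1))"
      if "0 < t" "0 \<le> B" and B: "\<And>z. norm z \<le> t \<Longrightarrow> w z \<le> ennreal B" for B
    proof -
      have "(\<integral>\<^sup>+z. w z * c z t \<partial>lborel) \<le> (\<integral>\<^sup>+z. ennreal (B * (a * t powr (- a - 1))) * indicator (cball (0::'a) t) z \<partial>lborel)"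
      proof (rule nn_integral_mono)
        fix z
        show "w z * c z t \<le> ennreal (B * (a * t powr (- a - 1))) * indicator (cball (0::'a) t) z"
          using B[of z] \<open>0 \<le> B\<close> a by (auto simp: c_def indicator_def ennreal_mult intro!: mult_right_mono)
      qed
      also have "\<dots> = ennreal (B * (a * t powr (- a - 1))) * ennreal (\<omega> * t ^ DIM('a))"
        using that(1) by (subst nn_integral_cmult_indicator) (auto simp: emeasure_cball \<omega>_def)
      also have "\<dots> = ennreal (B * (a * t powr (- a - 1)) * (\<omega> * t ^ DIM('a)))"
        using that a \<omega> by (simp add: ennreal_mult)
      also have "B * (a * t powr (- a - 1)) * (\<omega> * t ^ DIM('a)) = \<omega> * a * B * (t powr (- a - 1) * t powr (real DIM('a)))"
        using that(1) by (simp add: powr_realpow)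
      also have "t powr (- a - 1) * t powr (real DIM('a)) = t powr (- 2 * s - 1)"
        by (simp add: powr_add[symmetric] a_def)
      finally show ?thesis .
    qed
    consider "t \<le> 0" | "0 < t" "t \<le> 1" | "1 < t" by linarith
    then show "(\<integral>\<^sup>+z. w z * c z t \<partial>lborel) \<le> ennreal (\<omega> * a * E) * (ennreal (t powr (1 - 2 * s)) * indicator {0..1} t)
      + ennreal (\<omega> * a * (4 * L / (2 * s))) * (ennreal (2 * s * t powr (- (2 * s) - 1)) * indicator {1..} t)"
      (is "_ \<le> ?R1 + ?R2")
    proof cases
      case 1
      have "c z t = 0" for z
      proof (cases "t = 0")
        case False
        then have "\<not> norm z \<le> t" using 1 norm_ge_zero[of z] by linarith
        then show ?thesis by (simp add: c_def)
      qed (simp add: c_def)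
      then show ?thesis by simp
    next
      case 2
      have "(\<integral>\<^sup>+z. w z * c z t \<partial>lborel) \<le> ennreal (\<omega> * a * (E * t\<^sup>2) * t powr (- 2 * s - 1))"
      proof (rule slice)
        show "w z \<le> ennreal (E * t\<^sup>2)" if "norm z \<le> t" for z
          using trans[of z] that E unfolding w_def
          by (elim order_trans) (auto intro!: ennreal_leI mult_left_mono power_mono)
      qed (use 2 E in auto)
      also have "\<omega> * a * (E * t\<^sup>2) * t powr (- 2 * s - 1) = \<omega> * a * E * t powr (1 - 2 * s)"
      proof -
        have "t\<^sup>2 = t powr 2" using 2 by (simp add: powr_numeral)
        then have "t\<^sup>2 * t powr (- 2 * s - 1) = t powr (1 - 2 * s)"
          by (simp add: powr_add[symmetric])
        then show ?thesis by (simp add: mult.assoc)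
      qed
      also have "ennreal (\<omega> * a * E * t powr (1 - 2 * s)) = ?R1"
        using 2 \<omega> a E by (simp add: ennreal_mult)
      finally show ?thesis by (simp add: add_increasing2)
    next
      case 3
      have "(\<integral>\<^sup>+z. w z * c z t \<partial>lborel) \<le> ennreal (\<omega> * a * (4 * L) * t powr (- 2 * s - 1))"
        by (rule slice) (use 3 L w2 in auto)
      also have "\<dots> = ?R2"
        using 3 \<omega> a L s by (simp add: ennreal_mult[symmetric] field_simps)
      finally show ?thesis by (simp add: add_increasing)
    qed
  qed
  also have "\<dots> = ennreal (\<omega> * a * E) * ennreal (1 / (2 - 2 * s)) + ennreal (\<omega> * a * (4 * L / (2 * s))) * ennreal 1"
  proof -
    have "(\<integral>\<^sup>+t. ennreal (t powr (1 - 2 * s)) * indicator {0..1} t \<partial>lborel) = ennreal (1 / (2 - 2 * s))"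
      using nn_integral_powr_unit_interval[of "1 - 2 * s"] s by simp
    moreover have "(\<integral>\<^sup>+t. ennreal (2 * s * t powr (- (2 * s) - 1)) * indicator {1..} t \<partial>lborel) = ennreal 1"
      using powr_layer_cake[of 1 "2 * s"] s by simp
    ultimately show ?thesis
      by (subst nn_integral_add) (simp_all add: nn_integral_cmult)
  qed
  also have "\<dots> = ennreal (\<omega> * a * (E / (2 - 2 * s) + 4 * L / (2 * s)))"
    using \<omega> a E L s by (simp add: ennreal_mult[symmetric] ennreal_plus[symmetric] distrib_left del: ennreal_plus)
  finally show ?thesis
    unfolding a_def \<omega>_def .
qed

text \<open>Half of the singular exponent goes to each difference quotient, so that \<open>frac_form\<close> becomes an \<open>L\<^sup>2\<close> inner product.\<close>

definition dq :: "real \<Rightarrow> ('a::euclidean_space \<Rightarrow> real) \<Rightarrow> 'a \<times> 'a \<Rightarrow> real" where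
  "dq s u p = (u (fst p) - u (snd p)) / norm (fst p - snd p) powr ((real DIM('a) + 2 * s) / 2)"

lemma frac_form_dq:
  fixes u v :: "'a::euclidean_space \<Rightarrow> real"
  assumes "s \<noteq> 0"
  shows "frac_form s u v = cNs DIM('a) s * (\<integral>p. dq s u p \<bullet> dq s v p \<partial>(lebesgue \<Otimes>\<^sub>M lebesgue))"
proof -
  have "norm (fst p - snd p) powr ((real DIM('a) + 2 * s) / 2) * norm (fst p - snd p) powr ((real DIM('a) + 2 * s) / 2)
      = norm (fst p - snd p) powr (real DIM('a) + 2 * s)" for p :: "'a \<times> 'a"
    by (simp flip: powr_add)
  then show ?thesis
    using assms by (simp add: frac_form_def dq_def)
qed

lemma dq_power2:
  fixes u :: "'a::euclidean_space \<Rightarrow> real"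
  shows "(dq s u (x, y))\<^sup>2 = (u x - u y)\<^sup>2 / norm (x - y) powr (real DIM('a) + 2 * s)"
proof -
  have "(norm (x - y) powr ((real DIM('a) + 2 * s) / 2))\<^sup>2 = norm (x - y) powr (real DIM('a) + 2 * s)"
    unfolding power2_eq_square by (simp flip: powr_add)
  then show ?thesis by (simp add: dq_def power_divide)
qed

lemma fst_lebesgue_borel [measurable]:
  "fst \<in> (lebesgue \<Otimes>\<^sub>M M) \<rightarrow>\<^sub>M (borel :: 'a::euclidean_space measure)"
  and snd_lebesgue_borel [measurable]: "snd \<in> (M \<Otimes>\<^sub>M lebesgue) \<rightarrow>\<^sub>M (borel :: 'a::euclidean_space measure)"
  using measurable_compose[OF measurable_fst[of lebesgue M] measurable_completion[of "\<lambda>x. x" lborel borel]]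
    measurable_compose[OF measurable_snd[of M lebesgue] measurable_completion[of "\<lambda>x. x" lborel borel]]
  by simp_all

text \<open>Joint measurability in \<open>s\<close> and \<open>p\<close> is what makes the
  parametrised integral, hence the form, measurable in \<open>s\<close>, so that it can be
  integrated against \<open>\<mu>\<close>.\<close>

lemma dq_joint_measurable:
  fixes u :: "'a::euclidean_space \<Rightarrow> real"
  assumes "u \<in> borel_measurable lebesgue"
  shows "(\<lambda>(s, p). dq s u p) \<in> borel_measurable (borel \<Otimes>\<^sub>M (lebesgue \<Otimes>\<^sub>M lebesgue))"
proof -
  have [measurable]: "(\<lambda>p. u (fst p)) \<in> borel_measurable (lebesgue \<Otimes>\<^sub>M lebesgue)"
    "(\<lambda>p. u (snd p)) \<in> borel_measurable (lebesgue \<Otimes>\<^sub>M lebesgue)"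
    using assms by measurable
  have [measurable]: "(\<lambda>p::'a \<times> 'a. norm (fst p - snd p)) \<in> borel_measurable (lebesgue \<Otimes>\<^sub>M lebesgue)"
    by measurable
  show ?thesis
    unfolding dq_def by measurable
qed

lemma dq_measurable:
  "u \<in> borel_measurable lebesgue \<Longrightarrow> dq s u \<in> borel_measurable (lebesgue \<Otimes>\<^sub>M lebesgue)"
  using measurable_compose[OF measurable_Pair1'[of s borel] dq_joint_measurable] by simp

lemma H10_grad_L2:
  assumes "H10_grad \<Omega> u G"
  shows "L2 lebesgue u" "L2 lebesgue G"
  by (rule H10_gradE[OF assms]; assumption)+

text \<open>Written as an iterated integral, the seminorm ignores null sets in each variable
  separately. This permits replacing \<open>u\<close> by a Borel version and \<open>lebesgue\<close>
  by \<open>lborel\<close>, where the translation estimates apply.\<close>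

lemma H10_grad_gagliardo:
  fixes u :: "'a::euclidean_space \<Rightarrow> real"
  assumes "H10_grad \<Omega> u G" and s: "0 < s" "s < 1"
  shows "(\<integral>\<^sup>+p. ennreal ((norm (dq s u p))\<^sup>2) \<partial>(lebesgue \<Otimes>\<^sub>M lebesgue))
    \<le> ennreal (unit_ball_vol (real DIM('a)) * (real DIM('a) + 2 * s) *
        (6 * (\<integral>x. (norm (G x))\<^sup>2 \<partial>lebesgue) / (2 - 2 * s) + 4 * (\<integral>x. (norm (u x))\<^sup>2 \<partial>lebesgue) / (2 * s)))"
proof -
  note uG = H10_grad_L2[OF assms(1)]
  have um[measurable]: "u \<in> borel_measurable lebesgue" using uG by (simp add: L2_def)
  obtain u' where [measurable]: "u' \<in> borel_measurable borel" and ae: "AE x in lebesgue. u x = u' x"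
    using borel_representative[OF um] by blast
  note [measurable] = dq_measurable[OF um, of s]
  have "(\<integral>\<^sup>+p. ennreal ((norm (dq s u p))\<^sup>2) \<partial>(lebesgue \<Otimes>\<^sub>M lebesgue))
      = (\<integral>\<^sup>+x. \<integral>\<^sup>+y. ennreal ((norm (dq s u (x, y)))\<^sup>2) \<partial>lebesgue \<partial>lebesgue)"
    by (rule leb.nn_integral_fst[symmetric]) measurable
  also have "\<dots> = (\<integral>\<^sup>+x. \<integral>\<^sup>+y. ennreal ((norm (dq s u' (x, y)))\<^sup>2) \<partial>lebesgue \<partial>lebesgue)"
  proof (rule nn_integral_cong_AE, rule AE_mp[OF ae], intro AE_I2 impI)
    fix x assume "u x = u' x"
    then show "(\<integral>\<^sup>+y. ennreal ((norm (dq s u (x, y)))\<^sup>2) \<partial>lebesgue) = (\<integral>\<^sup>+y. ennreal ((norm (dq s u' (x, y)))\<^sup>2) \<partial>lebesgue)"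
      by (intro nn_integral_cong_AE, intro AE_mp[OF ae AE_I2]) (simp add: dq_def)
  qed
  also have "\<dots> = (\<integral>\<^sup>+x. \<integral>\<^sup>+y. ennreal ((u' x - u' y)\<^sup>2 / norm (x - y) powr (real DIM('a) + 2 * s)) \<partial>lborel \<partial>lborel)"
    by (simp add: nn_integral_completion dq_power2)
  also have "\<dots> \<le> ennreal (unit_ball_vol (real DIM('a)) * (real DIM('a) + 2 * s) *
        (6 * (\<integral>x. (norm (G x))\<^sup>2 \<partial>lebesgue) / (2 - 2 * s) + 4 * (\<integral>x. (norm (u x))\<^sup>2 \<partial>lebesgue) / (2 * s)))"
  proof (rule gagliardo_bound[OF _ s])
    show "(\<integral>\<^sup>+x. ennreal ((u' (x + z) - u' x)\<^sup>2) \<partial>lborel)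
        \<le> ennreal (6 * (\<integral>x. (norm (G x))\<^sup>2 \<partial>lebesgue) * (norm z)\<^sup>2)" for z
      by (rule H10_grad_translation_bound[OF assms(1) _ ae]) measurable
    have "(\<integral>\<^sup>+x. ennreal ((u' x)\<^sup>2) \<partial>lborel) = (\<integral>\<^sup>+x. ennreal ((u' x)\<^sup>2) \<partial>lebesgue)"
      by (simp add: nn_integral_completion)
    also have "\<dots> = (\<integral>\<^sup>+x. ennreal ((norm (u x))\<^sup>2) \<partial>lebesgue)"
      using ae by (intro nn_integral_cong_AE, eventually_elim) simp
    also have "\<dots> = ennreal (\<integral>x. (norm (u x))\<^sup>2 \<partial>lebesgue)"
      by (rule nn_integral_eq_integral[OF L2_integrable[OF uG(1)]]) simp
    finally show "(\<integral>\<^sup>+x. ennreal ((u' x)\<^sup>2) \<partial>lborel) \<le> ennreal (\<integral>x. (norm (u x))\<^sup>2 \<partial>lebesgue)"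
      by simp
  qed (auto intro: integral_nonneg_AE)
  finally show ?thesis .
qed

lemma H10_grad_dq_L2:
  assumes "H10_grad \<Omega> u G" "0 < s" "s < 1"
  shows "L2 (lebesgue \<Otimes>\<^sub>M lebesgue) (dq s u)"
proof -
  have m: "u \<in> borel_measurable lebesgue" using assms(1) by (simp add: H10_grad_def)
  have "(\<integral>\<^sup>+p. ennreal (norm ((norm (dq s u p))\<^sup>2)) \<partial>(lebesgue \<Otimes>\<^sub>M lebesgue)) < \<infinity>"
    using le_less_trans[OF H10_grad_gagliardo[OF assms]] by simp
  then show ?thesis
    unfolding L2_def using dq_measurable[OF m, of s] by (auto intro!: integrableI_bounded)
qed

section \<open>The normalising constant and bounds uniform in the exponent\<close>

lemma cNs_pos:
  assumes "0 < n" "0 < s" "s < 1"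
  shows "0 < cNs n s"
  using assms by (auto simp: cNs_def intro!: mult_pos_pos divide_pos_pos Gamma_real_pos)

text \<open>The factor \<open>s (1 - s)\<close> compensates the blow-up of the Gagliardo seminorm at both ends, which makes the
forms bounded uniformly in \<open>s\<close>.\<close>

lemma cNs_factor:
  assumes "0 < n"
  obtains F where "continuous_on {0..1} F" "\<And>s. cNs n s = F s * s * (1 - s)"
proof
  define F where "F s = 2 powr (2 * s - 1) * Gamma ((real n + 2 * s) / 2) / (pi powr (real n / 2) * Gamma (2 - s))" for s :: real
  have "continuous_on {0<..} (Gamma :: real \<Rightarrow> real)"
    by (rule continuous_on_Gamma) (auto elim!: nonpos_Ints_cases)
  note G = continuous_on_compose2[OF this]
  have "continuous_on {0..1} (\<lambda>s::real. Gamma ((real n + 2 * s) / 2))"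
    by (rule G) (use assms in \<open>auto intro!: continuous_intros add_pos_nonneg\<close>)
  moreover have "continuous_on {0..1} (\<lambda>s::real. Gamma (2 - s))"
    by (rule G) (auto intro!: continuous_intros)
  moreover have "Gamma (2 - s) \<noteq> 0" if "s \<in> {0..1}" for s :: real
  proof -
    have "0 < Gamma (2 - s)" by (rule Gamma_real_pos) (use that in auto)
    then show ?thesis by simp
  qed
  ultimately show "continuous_on {0..1} F"
    unfolding F_def
    by (intro continuous_on_divide continuous_on_mult continuous_on_powr continuous_on_const
        continuous_on_diff continuous_on_id) auto
  show "cNs n s = F s * s * (1 - s)" for s
    by (simp add: cNs_def F_def)
qed

lemma cNs_bound:
  assumes "0 < n"
  obtains K where "0 \<le> K" "\<And>s. 0 < s \<Longrightarrow> s < 1 \<Longrightarrow> cNs n s \<le> K * s * (1 - s)"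
proof -
  obtain F where F: "continuous_on {0..1} F" "\<And>s. cNs n s = F s * s * (1 - s)"
    by (rule cNs_factor[OF assms]) (rule that)
  have "bounded (F ` {0..1})"
    by (intro compact_imp_bounded compact_continuous_image F) auto
  then obtain B where B: "\<forall>s\<in>{0..1}. \<bar>F s\<bar> \<le> B"
    by (auto simp: bounded_iff)
  show ?thesis
  proof
    show "0 \<le> B" using B by (auto dest: bspec[of _ _ 0])
    show "cNs n s \<le> B * s * (1 - s)" if "0 < s" "s < 1" for s
      unfolding F(2) using bspec[OF B, of s] that by (intro mult_right_mono) auto
  qed
qed

lemma cNs_borel_measurable:
  assumes "0 < n" "b \<le> 1"
  shows "(\<lambda>s. indicator {0<..<b} s * cNs n s) \<in> borel_measurable borel"
proof -
  obtain F where F: "continuous_on {0..1} F" "\<And>s. cNs n s = F s * s * (1 - s)"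
    by (rule cNs_factor[OF assms(1)]) (rule that)
  have "continuous_on {0<..<b} (\<lambda>s. F s * s * (1 - s))"
    by (intro continuous_intros continuous_on_subset[OF F(1)]) (use assms in auto)
  from borel_measurable_continuous_on_indicator[OF _ this] show ?thesis
    by (simp add: F(2))
qed

text \<open>The domain on which \<open>frac_form\<close> is additive: square integrable quotients
  make every product integrable, so that no Bochner integral falls back on its default value
  0.\<close>

definition admissible :: "('a::euclidean_space \<Rightarrow> real) \<Rightarrow> bool" where
  "admissible u \<longleftrightarrow> L2 lebesgue u \<and>
     (\<forall>s. 0 < s \<longrightarrow> s < 1 \<longrightarrow> L2 (lebesgue \<Otimes>\<^sub>M lebesgue) (dq s u))"

lemma H10_grad_admissible: "H10_grad \<Omega> u G \<Longrightarrow> admissible u"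
  unfolding admissible_def using H10_grad_L2(1) H10_grad_dq_L2 by blast

lemma frac_form_0: "frac_form 0 u v = (\<integral>x. u x \<bullet> v x \<partial>lebesgue)"
  by (simp add: frac_form_def)

lemma frac_form_commute: "frac_form s u v = frac_form s v u"
  by (simp add: frac_form_def mult.commute)

lemma frac_form_add_left:
  assumes "admissible u" "admissible v" "admissible w" "0 \<le> s" "s < 1"
  shows "frac_form s (\<lambda>x. u x + v x) w = frac_form s u w + frac_form s v w"
proof (cases "s = 0")
  case True
  have "integrable lebesgue (\<lambda>x. u x \<bullet> w x)" "integrable lebesgue (\<lambda>x. v x \<bullet> w x)"
    using assms L2_inner[of lebesgue u w] L2_inner[of lebesgue v w] by (simp_all only: admissible_def)
  then show ?thesis
    by (simp add: True frac_form_0 inner_add_left del: inner_real_def)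
next
  case False
  then have "0 < s" using assms by simp
  then have "integrable (lebesgue \<Otimes>\<^sub>M lebesgue) (\<lambda>p. dq s u p \<bullet> dq s w p)"
    "integrable (lebesgue \<Otimes>\<^sub>M lebesgue) (\<lambda>p. dq s v p \<bullet> dq s w p)"
    using assms by (intro L2_inner; auto simp: admissible_def)+
  moreover have "dq s (\<lambda>x. u x + v x) p = dq s u p + dq s v p" for p
    unfolding dq_def add_divide_distrib[symmetric] by (simp add: algebra_simps)
  ultimately show ?thesis
    using False by (simp add: frac_form_dq distrib_right distrib_left)
qed

lemma frac_form_uminus_left: "frac_form s (\<lambda>x. - u x) v = - frac_form s u v"
proof -
  have "(- u (fst p) + u (snd p)) * c / d = - ((u (fst p) - u (snd p)) * c / d)" for p c d
    by (simp add: algebra_simps minus_divide_left)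
  then show ?thesis
    by (simp add: frac_form_def)
qed

lemma frac_sq_nonneg:
  fixes u :: "'a::euclidean_space \<Rightarrow> real"
  assumes "0 \<le> s" "s < 1"
  shows "0 \<le> frac_sq s u"
proof (cases "s = 0")
  case False
  then have "0 < cNs DIM('a) s" using assms by (intro cNs_pos) auto
  with False show ?thesis
    unfolding frac_sq_def frac_form_dq[OF False] by (auto intro!: mult_nonneg_nonneg integral_nonneg_AE)
qed (auto simp: frac_sq_def frac_form_0 intro: integral_nonneg_AE)

lemma frac_form_Cauchy_Schwarz:
  fixes u v :: "'a::euclidean_space \<Rightarrow> real"
  assumes "admissible u" "admissible v" "0 \<le> s" "s < 1"
  shows "(frac_form s u v)\<^sup>2 \<le> frac_sq s u * frac_sq s v"
proof (cases "s = 0")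
  case True
  then show ?thesis
    using assms L2_Cauchy_Schwarz[of lebesgue u v]
    by (simp add: frac_sq_def frac_form_0 admissible_def power2_eq_square)
next
  case False
  then have s: "0 < s" using assms by simp
  have "(\<integral>p. dq s u p \<bullet> dq s v p \<partial>(lebesgue \<Otimes>\<^sub>M lebesgue))\<^sup>2
    \<le> (\<integral>p. (norm (dq s u p))\<^sup>2 \<partial>(lebesgue \<Otimes>\<^sub>M lebesgue)) * (\<integral>p. (norm (dq s v p))\<^sup>2 \<partial>(lebesgue \<Otimes>\<^sub>M lebesgue))"
    using assms s by (intro L2_Cauchy_Schwarz) (auto simp: admissible_def)
  then have "(cNs DIM('a) s)\<^sup>2 * (\<integral>p. dq s u p \<bullet> dq s v p \<partial>(lebesgue \<Otimes>\<^sub>M lebesgue))\<^sup>2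
    \<le> (cNs DIM('a) s)\<^sup>2 * ((\<integral>p. (norm (dq s u p))\<^sup>2 \<partial>(lebesgue \<Otimes>\<^sub>M lebesgue)) * (\<integral>p. (norm (dq s v p))\<^sup>2 \<partial>(lebesgue \<Otimes>\<^sub>M lebesgue)))"
    by (rule mult_left_mono) simp
  then show ?thesis
    unfolding frac_sq_def frac_form_dq[OF False] by (simp add: power2_eq_square mult_ac)
qed

text \<open>The squared H^1 norm. The gradient is an explicit argument, so that a gradient known by
  construction can be used directly.\<close>

definition energy :: "('a::euclidean_space \<Rightarrow> real) \<Rightarrow> ('a \<Rightarrow> 'a) \<Rightarrow> real" where
  "energy u G = (\<integral>x. (norm (u x))\<^sup>2 \<partial>lebesgue) + (\<integral>x. (norm (G x))\<^sup>2 \<partial>lebesgue)"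

lemma energy_nonneg: "0 \<le> energy u G"
  unfolding energy_def by (intro add_nonneg_nonneg integral_nonneg_AE) auto

text \<open>The Gagliardo bound grows like the gradient term over \<open>1 - s\<close> plus the mass
  term over \<open>s\<close>; the factor \<open>s * (1 - s)\<close> of \<open>cNs\<close> cancels
  both. One constant therefore serves all \<open>s\<close>, all domains and all functions.\<close>

lemma frac_sq_bound:
  obtains C where "0 \<le> C"
    "\<And>s \<Omega> (u :: 'a::euclidean_space \<Rightarrow> real) G. 0 \<le> s \<Longrightarrow> s < 1 \<Longrightarrow> H10_grad \<Omega> u G \<Longrightarrow> frac_sq s u \<le> C * energy u G"
proof -
  obtain K where K: "0 \<le> K" "\<And>s. 0 < s \<Longrightarrow> s < 1 \<Longrightarrow> cNs DIM('a) s \<le> K * s * (1 - s)"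
    by (rule cNs_bound[of "DIM('a)"]) (use that in auto)
  define \<omega> where "\<omega> = unit_ball_vol (real DIM('a))"
  have \<omega>: "0 \<le> \<omega>" by (simp add: \<omega>_def)
  define N where "N = real DIM('a)"
  have N: "0 \<le> N" by (simp add: N_def)
  \<comment> \<open>The summand 1 covers \<open>s = 0\<close>, where the form is the L2 product. The
    rest covers \<open>0 < s\<close>, with \<open>N + 2 * s \<le> N + 2\<close> and
    \<open>3 * g * s + 2 * l * (1 - s) \<le> 3 * (l + g)\<close>.\<close>
  define C where "C = 1 + K * \<omega> * (N + 2) * 3"
  have C: "1 \<le> C" using K(1) \<omega> N by (simp add: C_def)
  show thesis
  proof
    show "0 \<le> C" using C by simp
    fix s :: real and \<Omega> and u :: "'a \<Rightarrow> real" and G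
    assume s: "0 \<le> s" "s < 1" and H: "H10_grad \<Omega> u G"
    define l where "l = (\<integral>x. (norm (u x))\<^sup>2 \<partial>lebesgue)"
    define g where "g = (\<integral>x. (norm (G x))\<^sup>2 \<partial>lebesgue)"
    have pos: "0 \<le> l" "0 \<le> g"
      by (auto simp: l_def g_def intro: integral_nonneg_AE)
    show "frac_sq s u \<le> C * energy u G"
    proof (cases "s = 0")
      case True
      have "frac_sq 0 u = l" by (simp add: frac_sq_def frac_form_0 l_def power2_eq_square)
      also have "l \<le> C * (l + g)"
        using mult_mono[of 1 C l "l + g"] C pos by simp
      finally show ?thesis by (simp add: energy_def l_def g_def True)
    next
      case False
      then have s0: "0 < s" using s by simp
      define B where "B = \<omega> * (N + 2 * s) * (6 * g / (2 - 2 * s) + 4 * l / (2 * s))"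
      have B0: "0 \<le> B" using \<omega> N s pos by (simp add: B_def)
      define Q where "Q = (\<integral>p. (norm (dq s u p))\<^sup>2 \<partial>(lebesgue \<Otimes>\<^sub>M lebesgue))"
      have "ennreal Q = (\<integral>\<^sup>+p. ennreal ((norm (dq s u p))\<^sup>2) \<partial>(lebesgue \<Otimes>\<^sub>M lebesgue))"
        unfolding Q_def by (rule nn_integral_eq_integral[symmetric, OF L2_integrable[OF H10_grad_dq_L2[OF H s0 s(2)]]]) simp
      also have "\<dots> \<le> ennreal B"
        unfolding B_def \<omega>_def N_def l_def g_def by (rule H10_grad_gagliardo[OF H s0 s(2)])
      finally have Q: "Q \<le> B" using B0 by (simp add: ennreal_le_iff)
      have "frac_sq s u = cNs DIM('a) s * Q"
        unfolding frac_sq_def frac_form_dq[OF False] Q_def by (simp add: power2_eq_square)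
      also have "\<dots> \<le> (K * s * (1 - s)) * B"
        by (rule mult_mono[OF K(2)[OF s0 s(2)] Q]) (use K s in \<open>auto simp: Q_def intro: integral_nonneg_AE\<close>)
      also have "\<dots> = K * \<omega> * (N + 2 * s) * (3 * g * s + 2 * l * (1 - s))"
        using s0 s by (simp add: B_def divide_simps) (simp add: algebra_simps)
      also have "\<dots> \<le> K * \<omega> * (N + 2) * (3 * (l + g))"
      proof (intro mult_mono)
        have "3 * g * s + 2 * l * (1 - s) \<le> 3 * g + 2 * l"
          using s pos by (intro add_mono) (auto intro: mult_left_le)
        then show "3 * g * s + 2 * l * (1 - s) \<le> 3 * (l + g)" using pos by simp
      qed (use K \<omega> N s pos in auto)
      also have "\<dots> \<le> C * (l + g)"
        using pos by (simp add: C_def algebra_simps)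
      finally show ?thesis by (simp add: energy_def l_def g_def)
    qed
  qed
qed

lemma frac_form_borel_measurable:
  fixes u v :: "'a::euclidean_space \<Rightarrow> real"
  assumes "u \<in> borel_measurable lebesgue" "v \<in> borel_measurable lebesgue" "b \<le> 1"
  shows "(\<lambda>s. indicator {0..<b} s * frac_form s u v) \<in> borel_measurable borel"
proof -
  define I where "I s = (\<integral>p. dq s u p \<bullet> dq s v p \<partial>(lebesgue \<Otimes>\<^sub>M lebesgue))" for s
  have "(\<lambda>s. integral\<^sup>L (lebesgue \<Otimes>\<^sub>M lebesgue) ((\<lambda>s p. dq s u p \<bullet> dq s v p) s)) \<in> borel_measurable borel"
    by (rule leb_pair.borel_measurable_lebesgue_integral)
      (use dq_joint_measurable[OF assms(1)] dq_joint_measurable[OF assms(2)] in \<open>simp add: case_prod_unfold\<close>)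
  then have [measurable]: "I \<in> borel_measurable borel" unfolding I_def by simp
  note [measurable] = cNs_borel_measurable[OF DIM_positive[where 'a='a] assms(3)]
  \<comment> \<open>The point \<open>s = 0\<close>, where the form has a definition of its own, is
    split off; elsewhere the form is \<open>cNs\<close> times a parametrised integral.\<close>
  have "(\<lambda>s. indicator {0..<b} s * frac_form s u v)
     = (\<lambda>s. (if s = 0 then indicator {0..<b} s * (\<integral>x. u x * v x \<partial>lebesgue) else 0)
          + indicator {0<..<b} s * cNs DIM('a) s * I s)"
  proof
    fix s :: real
    show "indicator {0..<b} s * frac_form s u v
     = (if s = 0 then indicator {0..<b} s * (\<integral>x. u x * v x \<partial>lebesgue) else 0)
          + indicator {0<..<b} s * cNs DIM('a) s * I s"
    proof (cases "s = 0")
      case False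
      then show ?thesis by (simp add: frac_form_dq I_def indicator_def)
    qed (simp add: frac_form_def indicator_def)
  qed
  then show ?thesis by simp
qed

section \<open>Uniqueness of the weak gradient\<close>

lemma compactly_supported_lipschitz:
  fixes f :: "'a::euclidean_space \<Rightarrow> real"
  assumes "smooth f" "compact (tsupp f)"
  obtains B where "0 \<le> B" "\<And>x y. \<bar>f x - f y\<bar> \<le> B * norm (x - y)"
proof -
  have "bounded (grad f ` tsupp f)"
    by (intro compact_imp_bounded compact_continuous_image continuous_on_grad assms)
  then obtain B where B: "\<forall>x\<in>tsupp f. norm (grad f x) \<le> B"
    by (auto simp: bounded_iff)
  \<comment> \<open>If \<open>tsupp f\<close> is empty, \<open>B\<close> is arbitrary and may be
    negative.\<close>
  have B': "norm (grad f x) \<le> max B 0" for x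
    using B grad_off_tsupp[of x f] by (cases "x \<in> tsupp f") auto
  have "norm (f x - f y) \<le> max B 0 * norm (x - y)" for x y
  proof (rule differentiable_bound[OF convex_UNIV])
    show "(f has_derivative frechet_derivative f (at z)) (at z within UNIV)" for z
      using smooth_has_derivative[OF assms(1)] by simp
    show "onorm (frechet_derivative f (at z)) \<le> max B 0" for z
    proof (rule onorm_le)
      fix w
      have "norm (frechet_derivative f (at z) w) \<le> norm (grad f z) * norm w"
        using Cauchy_Schwarz_ineq2[of "grad f z" w] by (simp add: smooth_grad_inner[OF assms(1)])
      also have "\<dots> \<le> max B 0 * norm w" using B'[of z] by (intro mult_right_mono) auto
      finally show "norm (frechet_derivative f (at z) w) \<le> max B 0 * norm w" .
    qed
  qed auto
  then show ?thesis using that[of "max B 0"] by simp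
qed

lemma integrable_continuous_compact_support:
  fixes f :: "'a::euclidean_space \<Rightarrow> real"
  assumes "continuous_on UNIV f" "compact K" "\<And>x. x \<notin> K \<Longrightarrow> f x = 0"
  shows "integrable lborel f"
proof -
  have "integrable lborel (\<lambda>x. indicator K x *\<^sub>R f x)"
    by (rule borel_integrable_compact[OF assms(2) continuous_on_subset[OF assms(1)]]) simp
  moreover have "(\<lambda>x. indicator K x *\<^sub>R f x) = f"
    using assms(3) by (force simp: indicator_def)
  ultimately show ?thesis by simp
qed

lemma lborel_integral_translate:
  fixes f :: "'a::euclidean_space \<Rightarrow> real"
  assumes [measurable]: "f \<in> borel_measurable borel"
  shows "(\<integral>x. f (x + z) \<partial>lborel) = (\<integral>x. f x \<partial>lborel)"
proof -
  have "(\<integral>x. f x \<partial>lborel) = (\<integral>x. f x \<partial>distr lborel borel ((+) z))"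
    by (simp add: lborel_distr_plus)
  also have "\<dots> = (\<integral>x. f (z + x) \<partial>lborel)"
    by (rule integral_distr) measurable
  finally show ?thesis by (simp add: add.commute)
qed

text \<open>By translation invariance every difference quotient of \<open>f\<close> has integral
  zero. The derivative is their dominated limit, because \<open>f\<close> is Lipschitz with compact
  support.\<close>

lemma integral_directional_derivative_eq_0:
  fixes f :: "'a::euclidean_space \<Rightarrow> real"
  assumes "smooth f" "compact (tsupp f)"
  shows "(\<integral>x. frechet_derivative f (at x) v \<partial>lebesgue) = 0"
proof -
  note [measurable] = smooth_borel_measurable[OF assms(1)]
    smooth_borel_measurable[OF smooth_frechet_derivative[OF assms(1), of v]]
  obtain B where B: "0 \<le> B" "\<And>x y. \<bar>f x - f y\<bar> \<le> B * norm (x - y)"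
    by (rule compactly_supported_lipschitz[OF assms]) (rule that)
  have int: "integrable lborel f"
    by (rule integrable_continuous_compact_support[where K = "tsupp f"])
      (simp_all add: smooth_continuous_on assms tsupp_eq_0)
  define h where "h n = inverse (real (Suc n))" for n
  have h: "0 < h n" "h n \<le> 1" for n by (auto simp: h_def field_simps)
  define S where "S n x = (f (x + h n *\<^sub>R v) - f x) / h n" for n x
  \<comment> \<open>The steps satisfy \<open>h n \<le> 1\<close>, so enlarging the support by
    \<open>norm v\<close> captures the supports of all difference quotients at once.\<close>
  define K where "K = {x + y | x y. x \<in> tsupp f \<and> y \<in> cball 0 (norm v)}"
  have K: "compact K" unfolding K_def by (rule compact_sums[OF assms(2) compact_cball])
  have int_shift: "integrable lborel (\<lambda>x. f (x + z))" for z
  proof (rule integrable_continuous_compact_support)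
    show "continuous_on UNIV (\<lambda>x. f (x + z))"
      by (rule continuous_on_compose2[OF smooth_continuous_on[OF assms(1), of UNIV]]) (auto intro: continuous_intros)
    show "compact ((\<lambda>x. (- z) + x) ` tsupp f)" by (rule compact_translation[OF assms(2)])
    show "f (x + z) = 0" if "x \<notin> (\<lambda>x. (- z) + x) ` tsupp f" for x
      using that tsupp_eq_0[of "x + z" f] by (force simp: image_iff)
  qed
  have S0: "(\<integral>x. S n x \<partial>lborel) = 0" for n
    unfolding S_def using int int_shift[of "h n *\<^sub>R v"] by (simp add: lborel_integral_translate)
  have "(\<lambda>n. \<integral>x. S n x \<partial>lborel) \<longlonglongrightarrow> (\<integral>x. frechet_derivative f (at x) v \<partial>lborel)"
  proof (rule integral_dominated_convergence)
    show "(\<lambda>x. frechet_derivative f (at x) v) \<in> borel_measurable lborel" by measurable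
    show "S n \<in> borel_measurable lborel" for n unfolding S_def by measurable
    have "integrable lborel (indicator K :: 'a \<Rightarrow> real)"
      using K emeasure_compact_finite[OF K] by (intro integrable_real_indicator) (auto simp: borel_compact)
    then show "integrable lborel (\<lambda>x. B * norm v * indicator K x)" by simp
    have "\<bar>S n x\<bar> \<le> B * norm v * indicator K x" for n x
    proof (cases "x \<in> K")
      case True
      have "\<bar>f (x + h n *\<^sub>R v) - f x\<bar> \<le> B * norm v * h n"
        using B(2)[of "x + h n *\<^sub>R v" x] h[of n] by (simp add: mult_ac)
      then show ?thesis
        using True h[of n] by (simp add: S_def divide_le_eq)
    next
      case False
      have "x \<notin> tsupp f" using False unfolding K_def by force
      moreover have "x + h n *\<^sub>R v \<notin> tsupp f"
      proof
        assume *: "x + h n *\<^sub>R v \<in> tsupp f"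
        have "- (h n *\<^sub>R v) \<in> cball 0 (norm v)"
          using h[of n] by (simp add: mult_left_le_one_le)
        moreover have "x = (x + h n *\<^sub>R v) + (- (h n *\<^sub>R v))" by simp
        ultimately have "x \<in> K" unfolding K_def using * by blast
        with False show False by simp
      qed
      ultimately show ?thesis
        by (simp add: S_def tsupp_eq_0 False)
    qed
    then show "AE x in lborel. norm (S n x) \<le> B * norm v * indicator K x" for n by simp
    have "(\<lambda>n. S n x) \<longlonglongrightarrow> frechet_derivative f (at x) v" for x
    proof -
      have "(\<lambda>t. (f (x + (0 + t) *\<^sub>R v) - f (x + 0 *\<^sub>R v)) / t) \<midarrow>0\<rightarrow> frechet_derivative f (at x) v"
        using smooth_has_line_derivative[OF assms(1), of x v 0] by (simp add: DERIV_def)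
      moreover have "filterlim h (at 0) sequentially"
        unfolding filterlim_at h_def using LIMSEQ_inverse_real_of_nat by auto
      ultimately have "(\<lambda>n. (f (x + (0 + h n) *\<^sub>R v) - f (x + 0 *\<^sub>R v)) / h n) \<longlonglongrightarrow> frechet_derivative f (at x) v"
        by (rule filterlim_compose)
      then show ?thesis by (simp add: S_def)
    qed
    then show "AE x in lborel. (\<lambda>n. S n x) \<longlonglongrightarrow> frechet_derivative f (at x) v" by simp
  qed
  then have "(\<integral>x. frechet_derivative f (at x) v \<partial>lborel) = 0"
    unfolding S0 by (simp add: LIMSEQ_const_iff)
  then show ?thesis
    by (simp add: integral_completion)
qed

lemma test_fun_frechet_derivative:
  assumes "test_fun \<Omega> f"
  shows "test_fun \<Omega> (\<lambda>x. frechet_derivative f (at x) v)"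
proof -
  have f: "smooth f" "compact (tsupp f)" "tsupp f \<subseteq> \<Omega>" using assms by (auto simp: test_fun_def)
  have "compact (tsupp (dird v f))"
    using compact_Int_closed[OF f(2) closed_tsupp[of "dird v f"]] tsupp_frechet_derivative[of f v]
    by (simp add: Int_absorb1)
  then show ?thesis
    using smooth_frechet_derivative[OF f(1)] order_trans[OF tsupp_frechet_derivative f(3)]
    by (simp add: test_fun_def)
qed

lemma integration_by_parts:
  assumes "test_fun \<Omega> f" "test_fun \<Omega> g"
  shows "(\<integral>x. dird v f x * g x \<partial>lebesgue) = - (\<integral>x. f x * dird v g x \<partial>lebesgue)"
proof -
  have f: "smooth f" "compact (tsupp f)" and g: "smooth g" using assms by (auto simp: test_fun_def)
  have sub: "tsupp (\<lambda>x. f x * g x) \<subseteq> tsupp f"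
  proof (rule tsupp_subset[OF closed_tsupp])
    show "x \<in> tsupp f" if "f x * g x \<noteq> 0" for x using that tsupp_eq_0[of x f] by auto
  qed
  have "compact (tsupp (\<lambda>x. f x * g x))"
    using compact_Int_closed[OF f(2) closed_tsupp[of "\<lambda>x. f x * g x"]] sub by (simp add: Int_absorb1)
  then have 0: "(\<integral>x. frechet_derivative (\<lambda>x. f x * g x) (at x) v \<partial>lebesgue) = 0"
    by (rule integral_directional_derivative_eq_0[OF smooth_mult[OF f(1) g]])
  have "frechet_derivative (\<lambda>x. f x * g x) (at x) v = f x * dird v g x + dird v f x * g x" for x
    by (simp add: frechet_derivative_at[OF has_derivative_mult[OF smooth_has_derivative[OF f(1)] smooth_has_derivative[OF g]], symmetric])
  moreover have "integrable lebesgue (\<lambda>x. f x * dird v g x)" "integrable lebesgue (\<lambda>x. dird v f x * g x)"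
    using L2_inner[OF test_fun_L2(1)[OF assms(1)] test_fun_L2(1)[OF test_fun_frechet_derivative[OF assms(2)]]]
      L2_inner[OF test_fun_L2(1)[OF test_fun_frechet_derivative[OF assms(1)]] test_fun_L2(1)[OF assms(2)]]
    by simp_all
  ultimately show ?thesis using 0 by simp
qed

lemma test_fun_laplacian_L2:
  fixes f :: "'a::euclidean_space \<Rightarrow> real"
  assumes "test_fun \<Omega> f"
  shows "L2 lebesgue (\<lambda>x. \<Sum>b\<in>Basis. dird b (dird b f) x)"
proof -
  have "L2 lebesgue (\<lambda>x. \<Sum>b\<in>S. dird b (dird b f) x)" if "finite S" for S
    using that
  proof induction
    case empty then show ?case by (simp add: L2_def)
  next
    case (insert b S)
    then show ?case
      using L2_add[OF test_fun_L2(1)[OF test_fun_frechet_derivative[OF test_fun_frechet_derivative[OF assms, of b], of b]] insert(3)]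
      by simp
  qed
  then show ?thesis by simp
qed

text \<open>The right side no longer mentions \<open>G\<close>: moving the second derivative onto
  \<open>f\<close> shows that the pairing of a weak gradient with gradients of test functions
  depends on \<open>u\<close> alone. The identity holds for the approximants of \<open>u\<close> and
  passes to the limit.\<close>

lemma weak_gradient_parts:
  assumes "test_fun \<Omega> f" "H10_grad \<Omega> u G"
  shows "(\<integral>x. grad f x \<bullet> G x \<partial>lebesgue) = - (\<integral>x. (\<Sum>b\<in>Basis. dird b (dird b f) x) * u x \<partial>lebesgue)"
proof -
  obtain \<phi> where \<phi>: "\<And>k. test_fun \<Omega> (\<phi> k)" "L2 lebesgue u" "L2 lebesgue G"
    and lim: "(\<lambda>k. \<integral>x. (norm (\<phi> k x - u x))\<^sup>2 \<partial>lebesgue) \<longlonglongrightarrow> 0"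
    "(\<lambda>k. \<integral>x. (norm (grad (\<phi> k) x - G x))\<^sup>2 \<partial>lebesgue) \<longlonglongrightarrow> 0"
    by (rule H10_gradE[OF assms(2)]) (rule that)
  note D = test_fun_frechet_derivative
  define l where "l x = (\<Sum>b\<in>Basis. dird b (dird b f) x)" for x
  have l2: "L2 lebesgue l" unfolding l_def by (rule test_fun_laplacian_L2[OF assms(1)])
  have smf: "smooth f" using assms(1) by (simp add: test_fun_def)
  have "(\<integral>x. grad f x \<bullet> grad (\<phi> k) x \<partial>lebesgue) = - (\<integral>x. l x * \<phi> k x \<partial>lebesgue)" for k
  proof -
    have sm: "smooth (\<phi> k)" using \<phi>(1)[of k] by (simp add: test_fun_def)
    have i1: "integrable lebesgue (\<lambda>x. dird b f x * dird b (\<phi> k) x)" for b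
      using L2_inner[OF test_fun_L2(1)[OF D[OF assms(1)]] test_fun_L2(1)[OF D[OF \<phi>(1)]]] by simp
    have i2: "integrable lebesgue (\<lambda>x. dird b (dird b f) x * \<phi> k x)" for b
      using L2_inner[OF test_fun_L2(1)[OF D[OF D[OF assms(1)]]] test_fun_L2(1)[OF \<phi>(1)]] by simp
    have "grad f x \<bullet> grad (\<phi> k) x = (\<Sum>b\<in>Basis. dird b f x * dird b (\<phi> k) x)" for x
      by (subst euclidean_inner) (simp add: smooth_grad_inner smf sm)
    then have "(\<integral>x. grad f x \<bullet> grad (\<phi> k) x \<partial>lebesgue) = (\<Sum>b\<in>Basis. \<integral>x. dird b f x * dird b (\<phi> k) x \<partial>lebesgue)"
      using i1 by simp
    also have "\<dots> = (\<Sum>b\<in>Basis. - (\<integral>x. dird b (dird b f) x * \<phi> k x \<partial>lebesgue))"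
      using integration_by_parts[OF D[OF assms(1)] \<phi>(1)] by (intro sum.cong) auto
    also have "\<dots> = - (\<integral>x. l x * \<phi> k x \<partial>lebesgue)"
      using i2 by (simp add: l_def sum_distrib_right sum_negf)
    finally show ?thesis .
  qed
  then have "(\<lambda>k. - (\<integral>x. l x \<bullet> \<phi> k x \<partial>lebesgue)) \<longlonglongrightarrow> (\<integral>x. grad f x \<bullet> G x \<partial>lebesgue)"
    using L2_inner_tendsto[OF test_fun_L2(2)[OF \<phi>(1)] \<phi>(3) test_fun_L2(2)[OF assms(1)] lim(2)] by simp
  moreover have "(\<lambda>k. - (\<integral>x. l x \<bullet> \<phi> k x \<partial>lebesgue)) \<longlonglongrightarrow> - (\<integral>x. l x \<bullet> u x \<partial>lebesgue)"
    by (intro tendsto_minus L2_inner_tendsto[OF test_fun_L2(1)[OF \<phi>(1)] \<phi>(2) l2 lim(1)])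
  ultimately show ?thesis
    using LIMSEQ_unique by (auto simp: l_def)
qed

text \<open>Integration by parts makes \<open>G - H\<close> orthogonal to gradients of test functions, hence to their limits \<open>G\<close> and \<open>H\<close>.\<close>

lemma weak_gradient_unique:
  assumes G: "H10_grad \<Omega> u G" and G': "H10_grad \<Omega> v H" and ae: "AE x in lebesgue. u x = v x"
  shows "AE x in lebesgue. G x = H x"
proof -
  note L = H10_grad_L2[OF G] H10_grad_L2[OF G']
  have L': "L2 lebesgue (\<lambda>x. G x - H x)" by (rule L2_diff[OF L(2,4)])
  have orth: "(\<integral>x. (G x - H x) \<bullet> grad f x \<partial>lebesgue) = 0" if f: "test_fun \<Omega> f" for f
  proof -
    have "(\<integral>x. (\<Sum>b\<in>Basis. dird b (dird b f) x) * u x \<partial>lebesgue)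
        = (\<integral>x. (\<Sum>b\<in>Basis. dird b (dird b f) x) * v x \<partial>lebesgue)"
      using L2_measurable[OF test_fun_laplacian_L2[OF f]] L2_measurable[OF L(1)] L2_measurable[OF L(3)] ae
      by (intro integral_cong_AE) auto
    then have "(\<integral>x. grad f x \<bullet> G x \<partial>lebesgue) = (\<integral>x. grad f x \<bullet> H x \<partial>lebesgue)"
      by (simp add: weak_gradient_parts[OF f G] weak_gradient_parts[OF f G'])
    moreover have "(\<integral>x. grad f x \<bullet> (G x - H x) \<partial>lebesgue) = (\<integral>x. grad f x \<bullet> G x \<partial>lebesgue) - (\<integral>x. grad f x \<bullet> H x \<partial>lebesgue)"
      using L2_inner[OF test_fun_L2(2)[OF f] L(2)] L2_inner[OF test_fun_L2(2)[OF f] L(4)]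
      by (simp add: inner_diff_right)
    ultimately show ?thesis by (simp add: inner_commute)
  qed
  have orth': "(\<integral>x. (G x - H x) \<bullet> J x \<partial>lebesgue) = 0" if w: "H10_grad \<Omega> w J" for w J
  proof -
    obtain \<phi> where \<phi>: "\<And>k. test_fun \<Omega> (\<phi> k)" "L2 lebesgue w" "L2 lebesgue J"
      and lim: "(\<lambda>k. \<integral>x. (norm (\<phi> k x - w x))\<^sup>2 \<partial>lebesgue) \<longlonglongrightarrow> 0"
      "(\<lambda>k. \<integral>x. (norm (grad (\<phi> k) x - J x))\<^sup>2 \<partial>lebesgue) \<longlonglongrightarrow> 0"
      by (rule H10_gradE[OF w]) (rule that)
    show ?thesis
      using L2_inner_tendsto[OF test_fun_L2(2)[OF \<phi>(1)] \<phi>(3) L' lim(2)] orth[OF \<phi>(1)]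
      by (simp add: LIMSEQ_const_iff)
  qed
  have "(\<integral>x. (norm (G x - H x))\<^sup>2 \<partial>lebesgue) = (\<integral>x. (G x - H x) \<bullet> G x - (G x - H x) \<bullet> H x \<partial>lebesgue)"
    by (simp add: power2_norm_eq_inner inner_diff_right)
  also have "\<dots> = 0"
    using L2_inner[OF L' L(2)] L2_inner[OF L' L(4)] orth'[OF G] orth'[OF G'] by simp
  finally show ?thesis
    using L2_eq_0[OF L'] by simp
qed

section \<open>Bilinear forms averaged over the spectral measure\<close>

definition mixed_form :: "real measure \<Rightarrow> real \<Rightarrow> ('a::euclidean_space \<Rightarrow> real) \<Rightarrow> ('a \<Rightarrow> real) \<Rightarrow> real" where
  "mixed_form \<mu> b u v = (LINT s:{0..<b}|\<mu>. frac_form s u v)"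

lemma frac_form_bound:
  obtains C where "0 \<le> C"
    "\<And>s \<Omega> \<Omega>' (u :: 'a::euclidean_space \<Rightarrow> real) G v H. 0 \<le> s \<Longrightarrow> s < 1 \<Longrightarrow> H10_grad \<Omega> u G \<Longrightarrow> H10_grad \<Omega>' v H
      \<Longrightarrow> \<bar>frac_form s u v\<bar> \<le> C * sqrt (energy u G * energy v H)"
proof -
  obtain C where C: "0 \<le> C"
    "\<And>s \<Omega> (u :: 'a \<Rightarrow> real) G. 0 \<le> s \<Longrightarrow> s < 1 \<Longrightarrow> H10_grad \<Omega> u G \<Longrightarrow> frac_sq s u \<le> C * energy u G"
    by (rule frac_sq_bound) (rule that)
  show thesis
  proof
    show "0 \<le> C" by fact
    fix s :: real and \<Omega> \<Omega>' and u v :: "'a \<Rightarrow> real" and G H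
    assume s: "0 \<le> s" "s < 1" and uv: "H10_grad \<Omega> u G" "H10_grad \<Omega>' v H"
    have "(frac_form s u v)\<^sup>2 \<le> frac_sq s u * frac_sq s v"
      by (intro frac_form_Cauchy_Schwarz s H10_grad_admissible[OF uv(1)] H10_grad_admissible[OF uv(2)])
    also have "\<dots> \<le> (C * energy u G) * (C * energy v H)"
      by (intro mult_mono C(2)[OF s uv(1)] C(2)[OF s uv(2)] frac_sq_nonneg s mult_nonneg_nonneg C(1) energy_nonneg)
    also have "\<dots> = (C * sqrt (energy u G * energy v H))\<^sup>2"
      using energy_nonneg[of u G] energy_nonneg[of v H]
      by (simp add: power_mult_distrib) (simp add: power2_eq_square)
    finally have "(frac_form s u v)\<^sup>2 \<le> (C * sqrt (energy u G * energy v H))\<^sup>2" .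
    then show "\<bar>frac_form s u v\<bar> \<le> C * sqrt (energy u G * energy v H)"
      by (rule abs_le_square_iff[THEN iffD2, of "frac_form s u v" "C * sqrt (energy u G * energy v H)", THEN order_trans])
        (use C(1) energy_nonneg[of u G] energy_nonneg[of v H] in simp)
  qed
qed

locale spectral_measure = finite_measure \<mu> for \<mu> :: "real measure" +
  fixes b :: real
  assumes sets_borel: "sets \<mu> = sets borel" and b: "b \<le> 1"
begin

text \<open>The bound on the form does not depend on \<open>s\<close>, so the integrand is bounded,
  and \<open>\<mu>\<close> is finite.\<close>

lemma set_integrable_frac_form:
  fixes u v :: "'a::euclidean_space \<Rightarrow> real"
  assumes "H10_grad \<Omega> u G" "H10_grad \<Omega>' v H"
  shows "set_integrable \<mu> {0..<b} (\<lambda>s. frac_form s u v)"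
proof -
  obtain C where C: "0 \<le> C"
    "\<And>s \<Omega> \<Omega>' (u :: 'a::euclidean_space \<Rightarrow> real) G v H. 0 \<le> s \<Longrightarrow> s < 1 \<Longrightarrow> H10_grad \<Omega> u G \<Longrightarrow> H10_grad \<Omega>' v H
      \<Longrightarrow> \<bar>frac_form s u v\<bar> \<le> C * sqrt (energy u G * energy v H)"
    by (rule frac_form_bound) (rule that)
  have "(\<lambda>s. indicator {0..<b} s * frac_form s u v) \<in> borel_measurable borel"
    by (rule frac_form_borel_measurable[OF _ _ b]) (use assms in \<open>auto simp: H10_grad_def\<close>)
  then have m: "(\<lambda>s. indicator {0..<b} s *\<^sub>R frac_form s u v) \<in> borel_measurable \<mu>"
    by (simp add: measurable_cong_sets[OF sets_borel])
  have "norm (indicator {0..<b} s *\<^sub>R frac_form s u v) \<le> C * sqrt (energy u G * energy v H)" for s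
    using C(2)[OF _ _ assms, of s] b C(1) energy_nonneg[of u G] energy_nonneg[of v H]
    by (auto simp: indicator_def)
  then show ?thesis
    unfolding set_integrable_def by (intro integrable_const_bound[OF _ m]) auto
qed

lemma mixed_form_add_left:
  fixes u v w :: "'a::euclidean_space \<Rightarrow> real"
  assumes "H10_grad \<Omega> u G" "H10_grad \<Omega> v H" "H10_grad \<Omega> w J"
  shows "mixed_form \<mu> b (\<lambda>x. u x + v x) w = mixed_form \<mu> b u w + mixed_form \<mu> b v w"
proof -
  have "mixed_form \<mu> b (\<lambda>x. u x + v x) w = (LINT s:{0..<b}|\<mu>. frac_form s u w + frac_form s v w)"
    unfolding mixed_form_def
  proof (rule set_lebesgue_integral_cong)
    show "{0..<b} \<in> sets \<mu>" by (simp add: sets_borel)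
    show "\<forall>s. s \<in> {0..<b} \<longrightarrow> frac_form s (\<lambda>x. u x + v x) w = frac_form s u w + frac_form s v w"
      using b by (auto intro!: frac_form_add_left H10_grad_admissible[OF assms(1)]
          H10_grad_admissible[OF assms(2)] H10_grad_admissible[OF assms(3)])
  qed
  also have "\<dots> = mixed_form \<mu> b u w + mixed_form \<mu> b v w"
    unfolding mixed_form_def
    by (intro set_integral_add set_integrable_frac_form[OF assms(1,3)] set_integrable_frac_form[OF assms(2,3)])
  finally show ?thesis .
qed

lemma mixed_form_commute: "mixed_form \<mu> b u v = mixed_form \<mu> b v u"
  by (simp add: mixed_form_def frac_form_commute)

lemma mixed_form_uminus_left: "mixed_form \<mu> b (\<lambda>x. - u x) v = - mixed_form \<mu> b u v"
  by (simp add: mixed_form_def frac_form_uminus_left set_lebesgue_integral_def)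

text \<open>Continuity in the H^1 norm, which lets the weak equation pass from test functions to
  their limits. The constant is the uniform one times the total mass of
  \<open>\<mu>\<close>.\<close>

lemma mixed_form_bound:
  obtains C where "0 \<le> C"
    "\<And>\<Omega> \<Omega>' (u :: 'a::euclidean_space \<Rightarrow> real) G v H. H10_grad \<Omega> u G \<Longrightarrow> H10_grad \<Omega>' v H
      \<Longrightarrow> \<bar>mixed_form \<mu> b u v\<bar> \<le> C * sqrt (energy u G * energy v H)"
proof -
  obtain C where C: "0 \<le> C"
    "\<And>s \<Omega> \<Omega>' (u :: 'a::euclidean_space \<Rightarrow> real) G v H. 0 \<le> s \<Longrightarrow> s < 1 \<Longrightarrow> H10_grad \<Omega> u G \<Longrightarrow> H10_grad \<Omega>' v H
      \<Longrightarrow> \<bar>frac_form s u v\<bar> \<le> C * sqrt (energy u G * energy v H)"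
    by (rule frac_form_bound) (rule that)
  show thesis
  proof
    show "0 \<le> measure \<mu> (space \<mu>) * C" using C(1) by simp
    fix \<Omega> \<Omega>' and u v :: "'a \<Rightarrow> real" and G H
    assume uv: "H10_grad \<Omega> u G" "H10_grad \<Omega>' v H"
    define e where "e = C * sqrt (energy u G * energy v H)"
    have e: "norm (indicator {0..<b} s *\<^sub>R frac_form s u v) \<le> e" for s
      using C(2)[OF _ _ uv, of s] b C(1) energy_nonneg[of u G] energy_nonneg[of v H]
      by (auto simp: indicator_def e_def)
    have "norm (mixed_form \<mu> b u v) \<le> (\<integral>s. norm (indicator {0..<b} s *\<^sub>R frac_form s u v) \<partial>\<mu>)"
      unfolding mixed_form_def set_lebesgue_integral_def by (rule integral_norm_bound)
    also have "\<dots> \<le> (\<integral>s. e \<partial>\<mu>)"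
      using set_integrable_frac_form[OF uv] e unfolding set_integrable_def
      by (intro integral_mono integrable_norm) auto
    finally show "\<bar>mixed_form \<mu> b u v\<bar> \<le> measure \<mu> (space \<mu>) * C * sqrt (energy u G * energy v H)"
      by (simp add: e_def mult.assoc)
  qed
qed

end

section \<open>Strict negativity of the forms on disjointly supported functions\<close>

lemma AE_lebesgue_pair:
  fixes P :: "'a::euclidean_space \<Rightarrow> bool"
  assumes "AE x in lebesgue. P x" "{x. P x} \<in> sets lebesgue"
  shows "AE p in lebesgue \<Otimes>\<^sub>M lebesgue. P (fst p) \<and> P (snd p)"
proof (rule leb_pair.AE_pair_measure)
  have [measurable]: "Measurable.pred lebesgue P"
    using assms(2) by (simp add: pred_def)
  show "{p \<in> space (lebesgue \<Otimes>\<^sub>M lebesgue). P (fst p) \<and> P (snd p)} \<in> sets (lebesgue \<Otimes>\<^sub>M lebesgue)"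
    by measurable
  show "AE x in lebesgue. AE y in lebesgue. P (fst (x, y)) \<and> P (snd (x, y))"
    using assms(1) by (auto intro: AE_mp)
qed

text \<open>The integrand is nonpositive almost everywhere, and strictness is the effect of
  nonlocality: all pairs of points interact, at whatever distance. Were the integral zero, Fubini
  would give a point \<open>x\<close> with \<open>u x \<noteq> 0\<close> from which
  \<open>v y = 0\<close> follows for almost every \<open>y\<close>.\<close>

lemma frac_form_neg:
  fixes u v :: "'a::euclidean_space \<Rightarrow> real"
  assumes "admissible u" "admissible v" "0 < s" "s < 1"
    and sgn: "AE x in lebesgue. 0 \<le> u x \<and> 0 \<le> v x \<and> u x * v x = 0"
    and nz: "nonzero_fun u" "nonzero_fun v"
  shows "frac_form s u v < 0"
proof -
  define P where "P x \<longleftrightarrow> 0 \<le> u x \<and> 0 \<le> v x \<and> u x * v x = 0" for x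
  have [measurable]: "u \<in> borel_measurable lebesgue" "v \<in> borel_measurable lebesgue"
    using assms(1,2) by (auto simp: admissible_def L2_def)
  have Pm: "{x. P x} \<in> sets lebesgue"
  proof -
    have "{x \<in> space lebesgue. P x} \<in> sets lebesgue" unfolding P_def by measurable
    then show ?thesis by simp
  qed
  have aeP: "AE x in lebesgue. P x" using sgn by (simp add: P_def)
  have L: "L2 (lebesgue \<Otimes>\<^sub>M lebesgue) (dq s u)" "L2 (lebesgue \<Otimes>\<^sub>M lebesgue) (dq s v)"
    using assms by (auto simp: admissible_def)
  have int: "integrable (lebesgue \<Otimes>\<^sub>M lebesgue) (\<lambda>p. - (dq s u p \<bullet> dq s v p))"
    using L2_inner[OF L] by simp
  have prod: "dq s u (x, y) * dq s v (x, y)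
      = - (u x * v y + u y * v x) / norm (x - y) powr (real DIM('a) + 2 * s)" if "P x" "P y" for x y
  proof -
    have "norm (x - y) powr ((real DIM('a) + 2 * s) / 2) * norm (x - y) powr ((real DIM('a) + 2 * s) / 2)
      = norm (x - y) powr (real DIM('a) + 2 * s)"
      by (simp flip: powr_add)
    moreover have "(u x - u y) * (v x - v y) = - (u x * v y + u y * v x)"
      using that by (auto simp: P_def algebra_simps)
    ultimately show ?thesis by (simp add: dq_def)
  qed
  have nonneg: "AE p in lebesgue \<Otimes>\<^sub>M lebesgue. 0 \<le> - (dq s u p \<bullet> dq s v p)"
    using AE_lebesgue_pair[OF aeP Pm]
  proof eventually_elim
    case (elim p)
    then show ?case
      using prod[of "fst p" "snd p"] by (auto simp: P_def intro!: divide_nonpos_nonneg)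
  qed
  have "0 \<le> (\<integral>p. - (dq s u p \<bullet> dq s v p) \<partial>(lebesgue \<Otimes>\<^sub>M lebesgue))"
    by (rule integral_nonneg_AE[OF nonneg])
  moreover have "(\<integral>p. - (dq s u p \<bullet> dq s v p) \<partial>(lebesgue \<Otimes>\<^sub>M lebesgue)) \<noteq> 0"
  proof
    assume "(\<integral>p. - (dq s u p \<bullet> dq s v p) \<partial>(lebesgue \<Otimes>\<^sub>M lebesgue)) = 0"
    then have "AE p in lebesgue \<Otimes>\<^sub>M lebesgue. - (dq s u p \<bullet> dq s v p) = 0"
      using integral_nonneg_eq_0_iff_AE[OF int nonneg] by simp
    from leb_pair.AE_pair[OF this]
    have "AE x in lebesgue. P x \<and> (AE y in lebesgue. dq s u (x, y) * dq s v (x, y) = 0)"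
      using aeP by eventually_elim simp
    moreover have "\<not> (AE x in lebesgue. u x = 0)" using nz(1) by (simp add: nonzero_fun_def)
    ultimately obtain x where x: "P x" "u x \<noteq> 0" "AE y in lebesgue. dq s u (x, y) * dq s v (x, y) = 0"
      by (metis (mono_tags, lifting) AE_mp AE_I2)
    have "AE y in lebesgue. v y = 0"
      using x(3) aeP
    proof eventually_elim
      case (elim y)
      have "v x = 0" using x(1,2) by (simp add: P_def)
      \<comment> \<open>At \<open>y = x\<close> the quotient carries no information, but there
        \<open>v y = v x = 0\<close>.\<close>
      moreover have "u x * v y + u y * v x = 0 \<or> x = y"
        using elim prod[OF x(1) elim(2)] by auto
      ultimately show "v y = 0" using x(2) by auto
    qed
    then show False using nz(2) by (simp add: nonzero_fun_def)
  qed
  ultimately have "(\<integral>p. dq s u p \<bullet> dq s v p \<partial>(lebesgue \<Otimes>\<^sub>M lebesgue)) < 0"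
    by simp
  moreover have "0 < cNs DIM('a) s" using assms by (intro cNs_pos) auto
  ultimately show ?thesis
    using assms by (simp add: frac_form_dq mult_pos_neg)
qed

text \<open>An atom of \<open>\<mu>\<close> at 0 contributes nothing, because the L2 product of
  disjointly supported functions is zero; the strict sign comes from the mass of the open
  interval.\<close>

lemma (in spectral_measure) mixed_form_neg:
  fixes u v :: "'a::euclidean_space \<Rightarrow> real"
  assumes uv: "H10_grad \<Omega> u G" "H10_grad \<Omega>' v H"
    and pos: "0 < emeasure \<mu> {0<..<b}"
    and sgn: "AE x in lebesgue. 0 \<le> u x \<and> 0 \<le> v x \<and> u x * v x = 0"
    and nz: "nonzero_fun u" "nonzero_fun v"
  shows "mixed_form \<mu> b u v < 0"
proof -
  define f where "f s = - (indicator {0..<b} s * frac_form s u v)" for s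
  have 0: "frac_form 0 u v = 0"
  proof -
    have "(\<integral>x. u x \<bullet> v x \<partial>lebesgue) = 0"
      by (rule integral_eq_zero_AE) (use sgn in eventually_elim, simp)
    then show ?thesis by (simp add: frac_form_0)
  qed
  have neg: "frac_form s u v < 0" if "0 < s" "s < b" for s
    using that b by (intro frac_form_neg H10_grad_admissible[OF uv(1)] H10_grad_admissible[OF uv(2)] sgn nz) auto
  have f0: "0 \<le> f s" for s
    using neg[of s] 0 by (cases "s = 0") (auto simp: f_def indicator_def)
  have int: "integrable \<mu> f"
    using set_integrable_frac_form[OF uv] unfolding f_def[abs_def] by (simp add: set_integrable_def)
  have "integral\<^sup>L \<mu> f \<noteq> 0"
  proof
    assume "integral\<^sup>L \<mu> f = 0"
    then have "AE s in \<mu>. f s = 0"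
      using integral_nonneg_eq_0_iff_AE[OF int] f0 by simp
    then have "AE s in \<mu>. s \<notin> {0<..<b}"
    proof eventually_elim
      case (elim s)
      then show ?case using neg[of s] by (auto simp: f_def indicator_def)
    qed
    then have "emeasure \<mu> {0<..<b} = 0"
      by (subst (asm) AE_iff_measurable[of "{0<..<b}"]) (auto simp: sets_borel sets_eq_imp_space_eq[OF sets_borel])
    with pos show False by simp
  qed
  moreover have "0 \<le> integral\<^sup>L \<mu> f" by (rule integral_nonneg_AE) (simp add: f0)
  moreover have "mixed_form \<mu> b u v = - integral\<^sup>L \<mu> f"
    unfolding f_def[abs_def] by (simp add: mixed_form_def set_lebesgue_integral_def)
  ultimately show ?thesis by linarith
qed

section \<open>Operations on Sobolev functions\<close>

lemma test_fun_H10_grad: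
  assumes "test_fun \<Omega> f"
  shows "H10_grad \<Omega> f (grad f)"
  by (rule H10_gradI[where \<phi> = "\<lambda>_. f"]) (use assms test_fun_L2[OF assms] in auto)

lemma H10_grad_uminus:
  assumes "H10_grad \<Omega> u G"
  shows "H10_grad \<Omega> (\<lambda>x. - u x) (\<lambda>x. - G x)"
proof -
  obtain \<phi> where \<phi>: "\<And>k. test_fun \<Omega> (\<phi> k)" "L2 lebesgue u" "L2 lebesgue G"
    and lim: "(\<lambda>k. \<integral>x. (norm (\<phi> k x - u x))\<^sup>2 \<partial>lebesgue) \<longlonglongrightarrow> 0"
    "(\<lambda>k. \<integral>x. (norm (grad (\<phi> k) x - G x))\<^sup>2 \<partial>lebesgue) \<longlonglongrightarrow> 0"
    by (rule H10_gradE[OF assms]) (rule that)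
  \<comment> \<open>Negation is obtained from differences: the zero function first, then zero minus
    \<open>\<phi> k\<close>.\<close>
  have z: "test_fun \<Omega> (\<lambda>x. \<phi> k x - \<phi> k x)" for k
    by (rule test_fun_diff[OF \<phi>(1) \<phi>(1)])
  have t: "test_fun \<Omega> (\<lambda>x. - \<phi> k x)" for k
    using test_fun_diff[OF z[of k] \<phi>(1)[of k]] by simp
  have sm: "smooth (\<phi> k)" for k using \<phi>(1) by (simp add: test_fun_def)
  have g: "grad (\<lambda>x. - \<phi> k x) x = - grad (\<phi> k) x" for k x
    by (rule grad_eqI[OF has_derivative_minus[OF smooth_has_derivative[OF sm]]])
      (simp add: smooth_grad_inner[OF sm])
  show ?thesis
  proof (rule H10_gradI[OF t])
    show "L2 lebesgue (\<lambda>x. - u x)" "L2 lebesgue (\<lambda>x. - G x)"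
      using L2_scaleR[OF \<phi>(2), of "-1"] L2_scaleR[OF \<phi>(3), of "-1"] by simp_all
    have "(norm (- \<phi> k x - - u x))\<^sup>2 = (norm (\<phi> k x - u x))\<^sup>2" for k x
      by (simp add: power2_commute)
    then show "(\<lambda>k. \<integral>x. (norm (- \<phi> k x - - u x))\<^sup>2 \<partial>lebesgue) \<longlonglongrightarrow> 0"
      using lim(1) by simp
    have "norm (grad (\<lambda>x. - \<phi> k x) x - - G x) = norm (grad (\<phi> k) x - G x)" for k x
      unfolding g by (simp add: norm_minus_commute)
    then show "(\<lambda>k. \<integral>x. (norm (grad (\<lambda>x. - \<phi> k x) x - - G x))\<^sup>2 \<partial>lebesgue) \<longlonglongrightarrow> 0"
      using lim(2) by simp
  qed
qed

lemma H10_grad_test_diff: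
  assumes f: "test_fun \<Omega> f" and u: "H10_grad \<Omega> u G"
  shows "H10_grad \<Omega> (\<lambda>x. f x - u x) (\<lambda>x. grad f x - G x)"
proof -
  obtain \<phi> where \<phi>: "\<And>k. test_fun \<Omega> (\<phi> k)" "L2 lebesgue u" "L2 lebesgue G"
    and lim: "(\<lambda>k. \<integral>x. (norm (\<phi> k x - u x))\<^sup>2 \<partial>lebesgue) \<longlonglongrightarrow> 0"
    "(\<lambda>k. \<integral>x. (norm (grad (\<phi> k) x - G x))\<^sup>2 \<partial>lebesgue) \<longlonglongrightarrow> 0"
    by (rule H10_gradE[OF u]) (rule that)
  have sm: "smooth f" "smooth (\<phi> k)" for k using \<phi>(1) f by (simp_all add: test_fun_def)
  show ?thesis
  proof (rule H10_gradI[OF test_fun_diff[OF f \<phi>(1)]])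
    show "L2 lebesgue (\<lambda>x. f x - u x)" "L2 lebesgue (\<lambda>x. grad f x - G x)"
      by (intro L2_diff test_fun_L2[OF f] \<phi>)+
    have "norm (f x - \<phi> k x - (f x - u x)) = norm (\<phi> k x - u x)" for k x
      by simp
    then show "(\<lambda>k. \<integral>x. (norm (f x - \<phi> k x - (f x - u x)))\<^sup>2 \<partial>lebesgue) \<longlonglongrightarrow> 0"
      using lim(1) by (simp only:)
    have "norm (grad (\<lambda>x. f x - \<phi> k x) x - (grad f x - G x)) = norm (grad (\<phi> k) x - G x)" for k x
      unfolding grad_diff[OF sm(1) sm(2)] by (simp add: norm_minus_commute)
    then show "(\<lambda>k. \<integral>x. (norm (grad (\<lambda>x. f x - \<phi> k x) x - (grad f x - G x)))\<^sup>2 \<partial>lebesgue) \<longlonglongrightarrow> 0"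
      using lim(2) by (simp only:)
  qed
qed

text \<open>Multiplication by an indicator never increases an L2 norm, so the cut-off approximants
  converge to the cut-off limit. The assumptions \<open>t\<close> and \<open>g\<close> isolate what
  has to hold for test functions, so that \<open>S\<close> may be an open piece or the complement of
  one.\<close>

lemma H10_grad_indicator:
  assumes u: "H10_grad \<Omega> u G" and S: "S \<in> sets lebesgue"
    and t: "\<And>f. test_fun \<Omega> f \<Longrightarrow> test_fun \<Omega> (\<lambda>x. indicator S x * f x)"
    and g: "\<And>f x. test_fun \<Omega> f \<Longrightarrow> grad (\<lambda>x. indicator S x * f x) x = indicator S x *\<^sub>R grad f x"
  shows "H10_grad \<Omega> (\<lambda>x. indicator S x * u x) (\<lambda>x. indicator S x *\<^sub>R G x)"
proof -
  obtain \<phi> where \<phi>: "\<And>k. test_fun \<Omega> (\<phi> k)" "L2 lebesgue u" "L2 lebesgue G"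
    and lim: "(\<lambda>k. \<integral>x. (norm (\<phi> k x - u x))\<^sup>2 \<partial>lebesgue) \<longlonglongrightarrow> 0"
    "(\<lambda>k. \<integral>x. (norm (grad (\<phi> k) x - G x))\<^sup>2 \<partial>lebesgue) \<longlonglongrightarrow> 0"
    by (rule H10_gradE[OF u]) (rule that)
  have L: "L2 lebesgue (\<lambda>x. indicator S x * u x)" "L2 lebesgue (\<lambda>x. indicator S x *\<^sub>R G x)"
    using L2_indicator[OF \<phi>(2) S] L2_indicator[OF \<phi>(3) S] by simp_all
  have le: "(\<integral>x. (norm (indicator S x *\<^sub>R h x))\<^sup>2 \<partial>lebesgue) \<le> (\<integral>x. (norm (h x))\<^sup>2 \<partial>lebesgue)"
    if "L2 lebesgue h" for h :: "'a \<Rightarrow> 'b::euclidean_space"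
    by (rule integral_mono[OF L2_integrable[OF L2_indicator[OF that S]] L2_integrable[OF that]])
      (simp add: indicator_def)
  show ?thesis
  proof (rule H10_gradI[OF t[OF \<phi>(1)] L])
    have "(\<integral>x. (norm (indicator S x * \<phi> k x - indicator S x * u x))\<^sup>2 \<partial>lebesgue)
        \<le> (\<integral>x. (norm (\<phi> k x - u x))\<^sup>2 \<partial>lebesgue)" for k
      using le[OF L2_diff[OF test_fun_L2(1)[OF \<phi>(1)] \<phi>(2)], of k] by (simp add: right_diff_distrib)
    then show "(\<lambda>k. \<integral>x. (norm (indicator S x * \<phi> k x - indicator S x * u x))\<^sup>2 \<partial>lebesgue) \<longlonglongrightarrow> 0"
      by (intro tendsto_sandwich[OF _ _ tendsto_const lim(1)] always_eventually allI integral_nonneg_AE) auto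
    have "(\<integral>x. (norm (grad (\<lambda>x. indicator S x * \<phi> k x) x - indicator S x *\<^sub>R G x))\<^sup>2 \<partial>lebesgue)
        \<le> (\<integral>x. (norm (grad (\<phi> k) x - G x))\<^sup>2 \<partial>lebesgue)" for k
      unfolding g[OF \<phi>(1)]
      using le[OF L2_diff[OF test_fun_L2(2)[OF \<phi>(1)] \<phi>(3)], of k] by (simp add: scaleR_diff_right)
    then show "(\<lambda>k. \<integral>x. (norm (grad (\<lambda>x. indicator S x * \<phi> k x) x - indicator S x *\<^sub>R G x))\<^sup>2 \<partial>lebesgue) \<longlonglongrightarrow> 0"
      by (intro tendsto_sandwich[OF _ _ tendsto_const lim(2)] always_eventually allI integral_nonneg_AE) auto
  qed
qed

text \<open>The second piece is cut off by \<open>- A\<close> rather than by \<open>B\<close>, so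
  that the two pieces add up to \<open>u\<close> at every point. On test functions the two cut-offs
  coincide.\<close>

lemma H10_grad_restrict:
  assumes "H10_grad \<Omega> u G" "\<Omega> = A \<union> B" "open A" "open B" "A \<inter> B = {}"
  shows "H10_grad \<Omega> (\<lambda>x. indicator A x * u x) (\<lambda>x. indicator A x *\<^sub>R G x)"
    and "H10_grad \<Omega> (\<lambda>x. indicator (- A) x * u x) (\<lambda>x. indicator (- A) x *\<^sub>R G x)"
proof -
  have *: "test_fun \<Omega> (\<lambda>x. indicator C x * f x) \<and> grad (\<lambda>x. indicator C x * f x) x = indicator C x *\<^sub>R grad f x"
    if "test_fun \<Omega> f" "\<Omega> = C \<union> E" "open C" "open E" "C \<inter> E = {}" for f x and C E :: "'a set"
    using test_fun_mono[OF test_fun_restrict[OF that], of \<Omega>] that(2)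
      grad_restrict[OF _ _ that(3-5), of f x] that(1) by (auto simp: test_fun_def)
  show "H10_grad \<Omega> (\<lambda>x. indicator A x * u x) (\<lambda>x. indicator A x *\<^sub>R G x)"
    by (rule H10_grad_indicator[OF assms(1)]) (use *[OF _ assms(2-5)] assms(3) in auto)
  have e: "indicator (- A) x * f x = indicator B x * f x"
    "indicator (- A) x *\<^sub>R grad f x = indicator B x *\<^sub>R grad f x" if "test_fun \<Omega> f" for f x
  proof -
    have "x \<in> A \<or> x \<in> B \<or> x \<notin> tsupp f"
      using that assms(2) by (auto simp: test_fun_def)
    then show "indicator (- A) x * f x = indicator B x * f x"
      "indicator (- A) x *\<^sub>R grad f x = indicator B x *\<^sub>R grad f x"
      using assms(5) tsupp_eq_0[of x f] grad_off_tsupp[of x f] by (auto simp: indicator_def)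
  qed
  have B: "test_fun \<Omega> (\<lambda>x. indicator B x * f x)"
    "grad (\<lambda>x. indicator B x * f x) x = indicator B x *\<^sub>R grad f x" if "test_fun \<Omega> f" for f x
    using *[OF that _ assms(4,3), of x] assms(2,5) by (simp_all add: Un_commute Int_commute)
  show "H10_grad \<Omega> (\<lambda>x. indicator (- A) x * u x) (\<lambda>x. indicator (- A) x *\<^sub>R G x)"
  proof (rule H10_grad_indicator[OF assms(1)])
    have "- A \<in> sets borel" using assms(3) by auto
    then show "- A \<in> sets lebesgue" by simp
  qed (simp_all only: e B)
qed

text \<open>The approximants vanish off \<open>\<Omega>\<close>, so the mass of \<open>u\<close>
  there is at most the squared L2 distance to any of them, which tends to 0.\<close>

lemma H10_grad_zero_outside:
  assumes u: "H10_grad \<Omega> u G" and "open \<Omega>"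
  shows "AE x in lebesgue. x \<notin> \<Omega> \<longrightarrow> u x = 0"
proof -
  have "H10_grad \<Omega> (\<lambda>x. indicator (- \<Omega>) x * u x) (\<lambda>x. indicator (- \<Omega>) x *\<^sub>R G x)"
    \<comment> \<open>The decomposition of \<open>\<Omega>\<close> into itself and the empty set,
      used here only for the square integrability of the part outside.\<close>
    by (rule H10_grad_restrict(2)[OF u, of \<Omega> "{}"]) (use assms in auto)
  then have L: "L2 lebesgue (\<lambda>x. indicator (- \<Omega>) x * u x)"
    by (rule H10_grad_L2)
  obtain \<phi> where \<phi>: "\<And>k. test_fun \<Omega> (\<phi> k)" "L2 lebesgue u" "L2 lebesgue G"
    and lim: "(\<lambda>k. \<integral>x. (norm (\<phi> k x - u x))\<^sup>2 \<partial>lebesgue) \<longlonglongrightarrow> 0"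
    "(\<lambda>k. \<integral>x. (norm (grad (\<phi> k) x - G x))\<^sup>2 \<partial>lebesgue) \<longlonglongrightarrow> 0"
    by (rule H10_gradE[OF u]) (rule that)
  have "(\<integral>x. (norm (indicator (- \<Omega>) x * u x))\<^sup>2 \<partial>lebesgue) \<le> (\<integral>x. (norm (\<phi> k x - u x))\<^sup>2 \<partial>lebesgue)" for k
  proof (rule integral_mono[OF L2_integrable[OF L] L2_integrable[OF L2_diff[OF test_fun_L2(1)[OF \<phi>(1)] \<phi>(2)]]])
    fix x
    show "(norm (indicator (- \<Omega>) x * u x))\<^sup>2 \<le> (norm (\<phi> k x - u x))\<^sup>2"
    proof (cases "x \<in> \<Omega>")
      case False
      then have "x \<notin> tsupp (\<phi> k)" using \<phi>(1)[of k] by (auto simp: test_fun_def)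
      then show ?thesis by (simp add: tsupp_eq_0 indicator_def)
    qed simp
  qed
  then have "(\<integral>x. (norm (indicator (- \<Omega>) x * u x))\<^sup>2 \<partial>lebesgue) \<le> 0"
    by (intro LIMSEQ_le_const[OF lim(1)]) auto
  moreover have "0 \<le> (\<integral>x. (norm (indicator (- \<Omega>) x * u x))\<^sup>2 \<partial>lebesgue)"
    by (rule integral_nonneg_AE) simp
  ultimately have "(\<integral>x. (norm (indicator (- \<Omega>) x * u x))\<^sup>2 \<partial>lebesgue) = 0"
    by (rule antisym)
  from L2_eq_0[OF L this] show ?thesis by eventually_elim (auto simp: indicator_def)
qed

text \<open>By the translation bound \<open>u\<close> agrees with its translate by a vector longer than the diameter of \<open>\<Omega>\<close>.\<close>

lemma H10_grad_zero_imp_zero: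
  fixes u :: "'a::euclidean_space \<Rightarrow> real"
  assumes u: "H10_grad \<Omega> u G" and \<Omega>: "open \<Omega>" "bounded \<Omega>" and G: "AE x in lebesgue. G x = 0"
  shows "AE x in lebesgue. u x = 0"
proof -
  have "u \<in> borel_measurable lebesgue" using u by (simp add: H10_grad_def)
  then obtain u' where [measurable]: "u' \<in> borel_measurable borel" and ae: "AE x in lebesgue. u x = u' x"
    by (rule borel_representative)
  \<comment> \<open>The Borel version is made to vanish off \<open>\<Omega>\<close> exactly, so that
    its value at the shifted point is zero for every \<open>x\<close> in \<open>\<Omega>\<close> and
    not just for almost every one.\<close>
  define w where "w x = indicator \<Omega> x * u' x" for x
  have [measurable]: "w \<in> borel_measurable borel"
  proof -
    have [measurable]: "\<Omega> \<in> sets borel" using \<Omega>(1) by simp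
    show ?thesis unfolding w_def by measurable
  qed
  have aew: "AE x in lebesgue. u x = w x"
    using ae H10_grad_zero_outside[OF u \<Omega>(1)] by eventually_elim (auto simp: w_def indicator_def)
  obtain R where R: "0 < R" "\<And>x. x \<in> \<Omega> \<Longrightarrow> norm x < R"
    using \<Omega>(2) by (meson bounded_pos_less)
  obtain e :: 'a where e: "norm e = 2 * R"
    using vector_choose_size[of "2 * R"] R(1) by auto
  have "(\<integral>x. (norm (G x))\<^sup>2 \<partial>lebesgue) = 0"
    by (rule integral_eq_zero_AE) (use G in eventually_elim, simp)
  then have "(\<integral>\<^sup>+x. ennreal ((w (x + e) - w x)\<^sup>2) \<partial>lborel) = 0"
    using H10_grad_translation_bound[OF u _ aew, of e] by simp
  then have "AE x in lborel. ennreal ((w (x + e) - w x)\<^sup>2) = 0"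
    by (subst (asm) nn_integral_0_iff_AE) auto
  then have "AE x in lborel. w x = 0"
  proof eventually_elim
    case (elim x)
    show ?case
    proof (cases "x \<in> \<Omega>")
      case True
      have "x + e \<notin> \<Omega>"
      proof
        assume "x + e \<in> \<Omega>"
        then have "norm (x + e) < R" "norm x < R" using R True by auto
        then show False using norm_triangle_ineq4[of "x + e" x] e by simp
      qed
      then have "w (x + e) = 0" by (simp add: w_def)
      with elim show ?thesis by (simp add: ennreal_eq_0_iff)
    qed (simp add: w_def)
  qed
  then have "AE x in lebesgue. w x = 0" by (rule AE_completion)
  with aew show ?thesis by eventually_elim simp
qed

text \<open>Rescaling and squaring a given test function avoids the construction of an explicit bump function.\<close>

lemma nonneg_test_fun_exists:
  fixes f :: "'a::euclidean_space \<Rightarrow> real" and c :: 'a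
  assumes f: "test_fun \<Omega> f" "f x0 \<noteq> 0" and B: "open B" "c \<in> B"
  obtains \<psi> where "test_fun B \<psi>" "\<And>x. 0 \<le> \<psi> x" "nonzero_fun \<psi>"
proof -
  have sf: "smooth f" "compact (tsupp f)" using f by (auto simp: test_fun_def)
  obtain R where R: "0 < R" "\<And>x. x \<in> tsupp f \<Longrightarrow> norm (x - x0) \<le> R"
  proof -
    have "bounded ((\<lambda>x. x - x0) ` tsupp f)"
      using compact_imp_bounded[OF sf(2)] by (intro bounded_translation_minus)
    then show ?thesis using that by (auto simp: bounded_pos)
  qed
  obtain \<epsilon> where \<epsilon>: "0 < \<epsilon>" "cball c \<epsilon> \<subseteq> B"
    using B open_contains_cball by blast
  \<comment> \<open>With this ratio the affine map below sends \<open>c\<close> to \<open>x0\<close>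
    and the ball of radius \<open>\<epsilon>\<close> about \<open>c\<close> onto the ball of radius
    \<open>R\<close> about \<open>x0\<close>, which contains the support of
    \<open>f\<close>.\<close>
  define r where "r = R / \<epsilon>"
  have r: "0 < r" using R \<epsilon> by (simp add: r_def)
  define g where "g x = f ((x0 - r *\<^sub>R c) + r *\<^sub>R x)" for x
  have sg: "smooth g" using smooth_affine[OF sf(1), of 1 "x0 - r *\<^sub>R c" r] by (simp add: g_def[abs_def])
  define \<psi> where "\<psi> x = g x * g x" for x
  have s: "smooth \<psi>" unfolding \<psi>_def by (rule smooth_mult[OF sg sg])
  have supp: "tsupp \<psi> \<subseteq> cball c \<epsilon>"
  proof (rule tsupp_subset[OF closed_cball])
    fix x assume "\<psi> x \<noteq> 0"
    then have "(x0 - r *\<^sub>R c) + r *\<^sub>R x \<in> tsupp f"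
      using tsupp_eq_0[of "(x0 - r *\<^sub>R c) + r *\<^sub>R x" f] by (auto simp: \<psi>_def g_def)
    from R(2)[OF this] have "norm (r *\<^sub>R (x - c)) \<le> R" by (simp add: algebra_simps)
    then have "r * norm (x - c) \<le> R" using r by simp
    then have "norm (x - c) \<le> \<epsilon>" using R \<epsilon> by (simp add: r_def field_simps)
    then show "x \<in> cball c \<epsilon>" by (simp add: dist_norm norm_minus_commute)
  qed
  have "compact (tsupp \<psi>)"
    using compact_Int_closed[OF compact_cball closed_tsupp[of \<psi>], of c \<epsilon>] supp by (simp add: Int_absorb1)
  then have t: "test_fun B \<psi>" using s supp \<epsilon>(2) by (auto simp: test_fun_def)
  have "nonzero_fun \<psi>"
    unfolding nonzero_fun_def
  proof
    assume "AE x in lebesgue. \<psi> x = 0"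
    have "open (\<psi> -` (- {0}))"
      by (rule open_vimage) (auto simp: smooth_continuous_on[OF s])
    then have o: "open {x. \<psi> x \<noteq> 0}" by (simp add: vimage_def)
    have "{x. \<psi> x \<noteq> 0} \<in> null_sets lebesgue"
      using \<open>AE x in lebesgue. \<psi> x = 0\<close> AE_iff_null_sets[of "{x. \<psi> x \<noteq> 0}" lebesgue] borel_open[OF o]
      by simp
    then have "negligible {x. \<psi> x \<noteq> 0}" by (simp add: negligible_iff_null_sets)
    moreover have "\<psi> c \<noteq> 0" using f(2) by (simp add: \<psi>_def g_def)
    ultimately show False using open_not_negligible[OF o] by auto
  qed
  then show ?thesis using that[OF t] by (simp add: \<psi>_def)
qed

section \<open>The first eigenvalue\<close>

lemma wgrad_H10_grad: "u \<in> H10 \<Omega> \<Longrightarrow> H10_grad \<Omega> u (wgrad \<Omega> u)"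
  by (simp add: H10_def wgrad_def someI_ex[of "H10_grad \<Omega> u"])

text \<open>By uniqueness the choice behind \<open>wgrad\<close> is immaterial, so any gradient at
  hand may stand in the Rayleigh quotient.\<close>

lemma wgrad_norm_integral:
  assumes "H10_grad \<Omega> u G"
  shows "(\<integral>x. (norm (wgrad \<Omega> u x))\<^sup>2 \<partial>lebesgue) = (\<integral>x. (norm (G x))\<^sup>2 \<partial>lebesgue)"
proof -
  have w: "H10_grad \<Omega> u (wgrad \<Omega> u)"
    by (rule wgrad_H10_grad) (use assms in \<open>auto simp: H10_def\<close>)
  have ae: "AE x in lebesgue. wgrad \<Omega> u x = G x"
    by (rule weak_gradient_unique[OF w assms]) simp
  show ?thesis
    using L2_measurable[OF H10_grad_L2(2)[OF w]] L2_measurable[OF H10_grad_L2(2)[OF assms]] ae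
    by (intro integral_cong_AE) (auto elim: AE_mp)
qed

context spectral_measure
begin

lemma mixed_form_self_nonneg: "0 \<le> mixed_form \<mu> b u u"
proof -
  have "0 \<le> indicator {0..<b} s *\<^sub>R frac_form s u u" for s
    using frac_sq_nonneg[of s u] b by (auto simp: frac_sq_def indicator_def)
  then show ?thesis
    unfolding mixed_form_def set_lebesgue_integral_def by (intro integral_nonneg_AE) simp
qed

lemma rayleigh_nonneg:
  "0 \<le> (\<integral>x. (norm (wgrad \<Omega> u x))\<^sup>2 \<partial>lebesgue) / (LINT s:{0..<b}|\<mu>. frac_sq s u)"
  using mixed_form_self_nonneg[of u]
  by (intro divide_nonneg_nonneg integral_nonneg_AE) (auto simp: mixed_form_def frac_sq_def)

lemma first_eig_nonneg:
  assumes "u \<in> H10 \<Omega>" "nonzero_fun u"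
  shows "0 \<le> first_eig \<Omega> \<mu> b"
  unfolding first_eig_def by (rule cINF_greatest) (use assms rayleigh_nonneg in auto)

text \<open>Minimality in product form. If the denominator is zero the quotient is 0 by convention
  and says nothing, but the product form then only asserts that the gradient integral is
  nonnegative.\<close>

lemma first_eig_le:
  assumes "H10_grad \<Omega> u G" "nonzero_fun u"
  shows "first_eig \<Omega> \<mu> b * mixed_form \<mu> b u u \<le> (\<integral>x. (norm (G x))\<^sup>2 \<partial>lebesgue)"
proof -
  define D where "D = mixed_form \<mu> b u u"
  have D: "0 \<le> D" unfolding D_def by (rule mixed_form_self_nonneg)
  have "first_eig \<Omega> \<mu> b \<le> (\<integral>x. (norm (wgrad \<Omega> u x))\<^sup>2 \<partial>lebesgue) / (LINT s:{0..<b}|\<mu>. frac_sq s u)"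
    unfolding first_eig_def
  proof (rule cINF_lower)
    show "u \<in> {u \<in> H10 \<Omega>. nonzero_fun u}" using assms by (auto simp: H10_def)
    show "bdd_below ((\<lambda>u. (\<integral>x. (norm (wgrad \<Omega> u x))\<^sup>2 \<partial>lebesgue) / (LINT s:{0..<b}|\<mu>. frac_sq s u)) ` {u \<in> H10 \<Omega>. nonzero_fun u})"
      by (rule bdd_belowI2[where m = 0]) (rule rayleigh_nonneg)
  qed
  also have "\<dots> = (\<integral>x. (norm (G x))\<^sup>2 \<partial>lebesgue) / D"
    unfolding wgrad_norm_integral[OF assms(1)] D_def mixed_form_def frac_sq_def ..
  finally have le: "first_eig \<Omega> \<mu> b \<le> (\<integral>x. (norm (G x))\<^sup>2 \<partial>lebesgue) / D" .
  show ?thesis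
  proof (cases "D = 0")
    case False
    then show ?thesis using le D by (simp add: D_def field_simps)
  qed (auto simp: D_def[symmetric] intro: integral_nonneg_AE)
qed

text \<open>This admits \<open>u\<close> itself and its restrictions as test functions. The local
  side converges by L2 convergence of the gradients, the nonlocal side by
  \<open>mixed_form_bound\<close> applied to the difference \<open>\<phi> k - w\<close>, whose
  energy tends to 0.\<close>

lemma weak_equation_H10:
  assumes u: "H10_grad \<Omega> u G" and w: "H10_grad \<Omega> w H"
    and eq: "\<And>v. test_fun \<Omega> v \<Longrightarrow> (\<integral>x. G x \<bullet> grad v x \<partial>lebesgue) = l * mixed_form \<mu> b u v"
  shows "(\<integral>x. G x \<bullet> H x \<partial>lebesgue) = l * mixed_form \<mu> b u w"
proof -
  obtain \<phi> where \<phi>: "\<And>k. test_fun \<Omega> (\<phi> k)" "L2 lebesgue w" "L2 lebesgue H"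
    and lim: "(\<lambda>k. \<integral>x. (norm (\<phi> k x - w x))\<^sup>2 \<partial>lebesgue) \<longlonglongrightarrow> 0"
    "(\<lambda>k. \<integral>x. (norm (grad (\<phi> k) x - H x))\<^sup>2 \<partial>lebesgue) \<longlonglongrightarrow> 0"
    by (rule H10_gradE[OF w]) (rule that)
  obtain C where C: "0 \<le> C"
    "\<And>\<Omega> \<Omega>' (u :: 'a \<Rightarrow> real) G v H. H10_grad \<Omega> u G \<Longrightarrow> H10_grad \<Omega>' v H
      \<Longrightarrow> \<bar>mixed_form \<mu> b u v\<bar> \<le> C * sqrt (energy u G * energy v H)"
    by (rule mixed_form_bound) (rule that)
  define d where "d k x = \<phi> k x - w x" for k x
  define e where "e k = energy (d k) (\<lambda>x. grad (\<phi> k) x - H x)" for k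
  have dH: "H10_grad \<Omega> (d k) (\<lambda>x. grad (\<phi> k) x - H x)" for k
    unfolding d_def by (rule H10_grad_test_diff[OF \<phi>(1) w])
  have "e \<longlonglongrightarrow> 0 + 0"
    unfolding e_def energy_def d_def by (intro tendsto_add lim)
  then have "(\<lambda>k. C * sqrt (energy u G * e k)) \<longlonglongrightarrow> C * sqrt (energy u G * 0)"
    by (intro tendsto_intros) simp
  then have e0: "(\<lambda>k. C * sqrt (energy u G * e k)) \<longlonglongrightarrow> 0" by simp
  have "mixed_form \<mu> b (\<phi> k) u - mixed_form \<mu> b w u = mixed_form \<mu> b (d k) u" for k
    using mixed_form_add_left[OF dH[of k] w u] by (simp add: d_def)
  then have "\<bar>mixed_form \<mu> b u (\<phi> k) - mixed_form \<mu> b u w\<bar> \<le> C * sqrt (energy u G * e k)" for k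
    using C(2)[OF u dH[of k]] by (simp add: e_def mixed_form_commute[of u])
  then have "(\<lambda>k. mixed_form \<mu> b u (\<phi> k) - mixed_form \<mu> b u w) \<longlonglongrightarrow> 0"
    by (intro Lim_null_comparison[OF _ e0]) simp
  then have "(\<lambda>k. mixed_form \<mu> b u (\<phi> k)) \<longlonglongrightarrow> mixed_form \<mu> b u w"
    by (rule LIM_zero_cancel)
  then have "(\<lambda>k. l * mixed_form \<mu> b u (\<phi> k)) \<longlonglongrightarrow> l * mixed_form \<mu> b u w"
    by (rule tendsto_mult_left)
  moreover have "(\<lambda>k. \<integral>x. G x \<bullet> grad (\<phi> k) x \<partial>lebesgue) \<longlonglongrightarrow> (\<integral>x. G x \<bullet> H x \<partial>lebesgue)"
    by (rule L2_inner_tendsto[OF test_fun_L2(2)[OF \<phi>(1)] \<phi>(3) H10_grad_L2(2)[OF u] lim(2)])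
  ultimately show ?thesis
    using LIMSEQ_unique unfolding eq[OF \<phi>(1)] by blast
qed

lemma not_vanishing_on_component:
  fixes u :: "'a::euclidean_space \<Rightarrow> real"
  assumes u: "H10_grad \<Omega> u G" "nonzero_fun u" "AE x in lebesgue. 0 \<le> u x"
    and eq: "\<And>v. test_fun \<Omega> v \<Longrightarrow> (\<integral>x. G x \<bullet> grad v x \<partial>lebesgue) = l * mixed_form \<mu> b u v"
    and l: "l \<noteq> 0" and \<mu>: "0 < emeasure \<mu> {0<..<b}"
    and \<Omega>: "\<Omega> = A \<union> B" "open A" "open B" "A \<inter> B = {}" "B \<noteq> {}"
  shows "\<not> (AE x in lebesgue. x \<in> B \<longrightarrow> u x = 0)"
proof
  assume 0: "AE x in lebesgue. x \<in> B \<longrightarrow> u x = 0"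
  obtain \<phi> where \<phi>: "\<And>k. test_fun \<Omega> (\<phi> k)" "L2 lebesgue u" "L2 lebesgue G"
    and lim: "(\<lambda>k. \<integral>x. (norm (\<phi> k x - u x))\<^sup>2 \<partial>lebesgue) \<longlonglongrightarrow> 0"
    by (rule H10_gradE[OF u(1)]) (rule that)
  \<comment> \<open>Supplies a nonzero test function to be rescaled into \<open>B\<close>: if all
    approximants were zero, so would be their limit \<open>u\<close>.\<close>
  have "\<exists>k x. \<phi> k x \<noteq> 0"
  proof (rule ccontr)
    assume "\<nexists>k x. \<phi> k x \<noteq> 0"
    then have "(\<integral>x. (norm (u x))\<^sup>2 \<partial>lebesgue) = 0"
      using lim by (simp add: LIMSEQ_const_iff)
    then show False using L2_eq_0[OF \<phi>(2)] u(2) by (simp add: nonzero_fun_def)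
  qed
  then obtain k x0 where "\<phi> k x0 \<noteq> 0" by blast
  moreover obtain c where "c \<in> B" using \<Omega>(5) by blast
  ultimately obtain \<psi> where \<psi>: "test_fun B \<psi>" "\<And>x. 0 \<le> \<psi> x" "nonzero_fun \<psi>"
    by (rule nonneg_test_fun_exists[OF \<phi>(1) _ \<Omega>(3)]) (rule that)
  have t: "test_fun \<Omega> \<psi>" by (rule test_fun_mono[OF \<psi>(1)]) (simp add: \<Omega>(1))
  have "H10_grad \<Omega> (\<lambda>x. indicator B x * u x) (\<lambda>x. indicator B x *\<^sub>R G x)"
    by (rule H10_grad_restrict(1)[OF u(1), of B A]) (use \<Omega> in auto)
  \<comment> \<open>The zero function in a form whose gradient is visibly zero. It agrees almost
    everywhere with \<open>u\<close> cut off to \<open>B\<close>, so uniqueness gives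
    \<open>G = 0\<close> almost everywhere on \<open>B\<close>.\<close>
  moreover have "H10_grad \<Omega> (\<lambda>x. \<psi> x - \<psi> x) (\<lambda>x. grad \<psi> x - grad \<psi> x)"
    by (rule H10_grad_test_diff[OF t test_fun_H10_grad[OF t]])
  ultimately have "AE x in lebesgue. indicator B x *\<^sub>R G x = grad \<psi> x - grad \<psi> x"
    by (rule weak_gradient_unique) (use 0 in eventually_elim, auto simp: indicator_def)
  then have "(\<integral>x. G x \<bullet> grad \<psi> x \<partial>lebesgue) = 0"
  proof (intro integral_eq_zero_AE, eventually_elim)
    case (elim x)
    show ?case
    proof (cases "x \<in> B")
      case False
      then have "x \<notin> tsupp \<psi>" using \<psi>(1) by (auto simp: test_fun_def)
      then show ?thesis by (simp add: grad_off_tsupp)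
    qed (use elim in simp)
  qed
  then have "mixed_form \<mu> b u \<psi> = 0" using eq[OF t] l by simp
  moreover have "mixed_form \<mu> b u \<psi> < 0"
  proof (rule mixed_form_neg[OF u(1) test_fun_H10_grad[OF t] \<mu> _ u(2) \<psi>(3)])
    show "AE x in lebesgue. 0 \<le> u x \<and> 0 \<le> \<psi> x \<and> u x * \<psi> x = 0"
      using u(3) 0
    proof eventually_elim
      case (elim x)
      have "x \<in> B \<or> \<psi> x = 0" using \<psi>(1) tsupp_eq_0[of x \<psi>] by (auto simp: test_fun_def)
      then show ?case using elim \<psi>(2) by auto
    qed
  qed
  ultimately show False by simp
qed

text \<open>The gradient is an arbitrary \<open>G\<close> instead of \<open>wgrad\<close>, so that
  the result applies to \<open>- u\<close> with \<open>- G\<close> as well.\<close>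

lemma first_eigenfunction_not_nonneg:
  fixes u :: "'a::euclidean_space \<Rightarrow> real"
  assumes u: "H10_grad \<Omega> u G" "nonzero_fun u"
    and eq: "\<And>v. test_fun \<Omega> v \<Longrightarrow> (\<integral>x. G x \<bullet> grad v x \<partial>lebesgue) = first_eig \<Omega> \<mu> b * mixed_form \<mu> b u v"
    and \<mu>: "0 < emeasure \<mu> {0<..<b}"
    and \<Omega>: "\<Omega> = A \<union> B" "open A" "open B" "A \<inter> B = {}" "A \<noteq> {}" "B \<noteq> {}" "bounded \<Omega>"
  shows "\<not> (AE x in lebesgue. 0 \<le> u x)"
proof
  assume nn: "AE x in lebesgue. 0 \<le> u x"
  define l where "l = first_eig \<Omega> \<mu> b"
  have u': "u \<in> H10 \<Omega>" using u(1) by (auto simp: H10_def)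
  have "open \<Omega>" using \<Omega> by auto
  note eq = eq[folded l_def]
  \<comment> \<open>Otherwise testing with \<open>u\<close> itself yields a zero gradient, and on a
    bounded open set this forces \<open>u = 0\<close>.\<close>
  have l0: "l \<noteq> 0"
  proof
    assume "l = 0"
    then have "(\<integral>x. (norm (G x))\<^sup>2 \<partial>lebesgue) = 0"
      using weak_equation_H10[OF u(1) u(1) eq] by (simp add: power2_norm_eq_inner)
    from L2_eq_0[OF H10_grad_L2(2)[OF u(1)] this]
    have "AE x in lebesgue. u x = 0"
      by (rule H10_grad_zero_imp_zero[OF u(1) \<open>open \<Omega>\<close> \<Omega>(7)])
    then show False using u(2) by (simp add: nonzero_fun_def)
  qed
  then have l: "0 < l"
    using first_eig_nonneg[OF u' u(2)] by (simp add: l_def)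
  define v where "v x = indicator A x * u x" for x
  define w where "w x = indicator (- A) x * u x" for x
  define H where "H x = indicator A x *\<^sub>R G x" for x
  have v: "H10_grad \<Omega> v H"
    unfolding v_def H_def by (rule H10_grad_restrict(1)[OF u(1) \<Omega>(1-4)])
  have w: "H10_grad \<Omega> w (\<lambda>x. indicator (- A) x *\<^sub>R G x)"
    unfolding w_def by (rule H10_grad_restrict(2)[OF u(1) \<Omega>(1-4)])
  have nzv: "nonzero_fun v"
    unfolding nonzero_fun_def
  proof
    assume "AE x in lebesgue. v x = 0"
    then have "AE x in lebesgue. x \<in> A \<longrightarrow> u x = 0"
      by eventually_elim (simp add: v_def indicator_def)
    moreover have "\<not> (AE x in lebesgue. x \<in> A \<longrightarrow> u x = 0)"
      by (rule not_vanishing_on_component[OF u nn eq l0 \<mu>, of B]) (use \<Omega> in auto)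
    ultimately show False by simp
  qed
  have nzw: "nonzero_fun w"
    unfolding nonzero_fun_def
  proof
    assume "AE x in lebesgue. w x = 0"
    then have "AE x in lebesgue. x \<in> B \<longrightarrow> u x = 0"
      by eventually_elim (use \<Omega>(4) in \<open>auto simp: w_def indicator_def split: if_splits\<close>)
    moreover have "\<not> (AE x in lebesgue. x \<in> B \<longrightarrow> u x = 0)"
      by (rule not_vanishing_on_component[OF u nn eq l0 \<mu>, of A]) (use \<Omega> in auto)
    ultimately show False by simp
  qed
  have "(\<lambda>x. v x + w x) = u"
    by (auto simp: v_def w_def indicator_def)
  then have split: "mixed_form \<mu> b u v = mixed_form \<mu> b v v + mixed_form \<mu> b w v"
    using mixed_form_add_left[OF v w v] by simp
  have "G x \<bullet> H x = (norm (H x))\<^sup>2" for x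
    by (simp add: H_def indicator_def power2_norm_eq_inner)
  then have "(\<integral>x. (norm (H x))\<^sup>2 \<partial>lebesgue) = l * mixed_form \<mu> b u v"
    using weak_equation_H10[OF u(1) v eq] by simp
  moreover have "l * mixed_form \<mu> b v v \<le> (\<integral>x. (norm (H x))\<^sup>2 \<partial>lebesgue)"
    unfolding l_def by (rule first_eig_le[OF v nzv])
  ultimately have "0 \<le> l * mixed_form \<mu> b w v"
    unfolding split by (simp add: distrib_left)
  moreover have "mixed_form \<mu> b w v < 0"
  proof (rule mixed_form_neg[OF w v \<mu> _ nzw nzv])
    show "AE x in lebesgue. 0 \<le> w x \<and> 0 \<le> v x \<and> w x * v x = 0"
      using nn by eventually_elim (auto simp: v_def w_def indicator_def)
  qed
  ultimately show False
    using l by (simp add: zero_le_mult_iff)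
qed

end

theorem theorem1p4:
  fixes Om :: "nat \<Rightarrow> 'a::euclidean_space set"
    and M :: nat and \<mu> :: "real measure" and sb :: real and u :: "'a \<Rightarrow> real"
  assumes "M \<ge> 2"
    and "\<And>j. j < M \<Longrightarrow> Om j \<noteq> {} \<and> open (Om j) \<and> bounded (Om j) \<and> connected (Om j) \<and> C1_boundary (Om j)"
    and "\<And>i j. i < M \<Longrightarrow> j < M \<Longrightarrow> i \<noteq> j \<Longrightarrow> closure (Om i) \<inter> closure (Om j) = {}"
    and "sets \<mu> = sets borel" and "finite_measure \<mu>"
    and "emeasure \<mu> (- {0..1}) = 0"
    and "0 < sb" and "sb < 1"
    and "emeasure \<mu> {0<..<sb} > 0"
    and "eigenfunction (\<Union>j<M. Om j) \<mu> sb (first_eig (\<Union>j<M. Om j) \<mu> sb) u"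
  shows "emeasure lebesgue {x. u x > 0} > 0 \<and> emeasure lebesgue {x. u x < 0} > 0"
proof -
  interpret spectral_measure \<mu> sb
    using assms(4,5,8) by (simp add: spectral_measure_def spectral_measure_axioms_def)
  define \<Omega> where "\<Omega> = (\<Union>j<M. Om j)"
  define A where "A = Om 0"
  define B where "B = (\<Union>j\<in>{1..<M}. Om j)"
  have "{..<M} = insert 0 {1..<M}" using assms(1) by auto
  then have \<Omega>: "\<Omega> = A \<union> B" by (simp add: \<Omega>_def A_def B_def)
  have Om: "Om j \<noteq> {}" "open (Om j)" "bounded (Om j)" if "j < M" for j
    using assms(2)[OF that] by auto
  have "Om i \<inter> Om j = {}" if "i < M" "j < M" "i \<noteq> j" for i j
    using assms(3)[OF that] closure_subset[of "Om i"] closure_subset[of "Om j"] by blast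
  from this[of 0] have disj: "A \<inter> B = {}" using assms(1) by (fastforce simp: A_def B_def)
  have op: "open A" "open B" using Om(2) assms(1) by (auto simp: A_def B_def)
  have ne: "A \<noteq> {}" "B \<noteq> {}"
    using Om(1)[of 0] Om(1)[of 1] assms(1) by (auto simp: A_def B_def intro!: bexI[of _ 1])
  have bd: "bounded \<Omega>" using Om(3) by (auto simp: \<Omega>_def)
  note split = assms(9) \<Omega> op disj ne bd
  define G where "G = wgrad \<Omega> u"
  have e: "u \<in> H10 \<Omega>" and nz: "nonzero_fun u"
    and eq: "\<And>v. test_fun \<Omega> v \<Longrightarrow> (\<integral>x. G x \<bullet> grad v x \<partial>lebesgue) = first_eig \<Omega> \<mu> sb * mixed_form \<mu> sb u v"
    using assms(10) by (auto simp: eigenfunction_def \<Omega>_def G_def mixed_form_def)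
  have G: "H10_grad \<Omega> u G" unfolding G_def by (rule wgrad_H10_grad[OF e])
  have um: "u \<in> borel_measurable lebesgue" using G by (simp add: H10_grad_def)
  have not_null: "0 < emeasure lebesgue {x. 0 < f x}"
    if "f \<in> borel_measurable lebesgue" "\<not> (AE x in lebesgue. f x \<le> 0)" for f :: "'a \<Rightarrow> real"
  proof (rule ccontr)
    assume "\<not> 0 < emeasure lebesgue {x. 0 < f x}"
    moreover have "{x \<in> space lebesgue. 0 < f x} \<in> sets lebesgue" using that(1) by measurable
    ultimately have "{x. 0 < f x} \<in> null_sets lebesgue" by (auto simp: null_sets_def)
    from AE_not_in[OF this] have "AE x in lebesgue. f x \<le> 0" by eventually_elim auto
    with that(2) show False by simp
  qed
  have "\<not> (AE x in lebesgue. 0 \<le> u x)"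
    by (rule first_eigenfunction_not_nonneg[OF G nz eq split])
  then have "0 < emeasure lebesgue {x. 0 < - u x}"
    using um by (intro not_null) auto
  \<comment> \<open>The weak equation is linear in \<open>u\<close>, so \<open>- u\<close> solves it
    for the same eigenvalue.\<close>
  moreover have "\<not> (AE x in lebesgue. 0 \<le> - u x)"
  proof (rule first_eigenfunction_not_nonneg[OF H10_grad_uminus[OF G] _ _ split])
    show "nonzero_fun (\<lambda>x. - u x)" using nz by (simp add: nonzero_fun_def)
    show "(\<integral>x. - G x \<bullet> grad v x \<partial>lebesgue) = first_eig \<Omega> \<mu> sb * mixed_form \<mu> sb (\<lambda>x. - u x) v"
      if "test_fun \<Omega> v" for v
      using eq[OF that] by (simp add: mixed_form_uminus_left)
  qed
  then have "0 < emeasure lebesgue {x. 0 < u x}"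
    using um by (intro not_null) auto
  ultimately show ?thesis by simp
qed

end
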